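(* Let $K_{2,3}^{+}$ denote the graph on five vertices obtained from the complete bipartite graph $K_{2,3}$ by adding one edge joining two of the three vertices of the part of size $3$, and let $W_4$ denote the wheel on five vertices, i.e. the graph obtained from a $4$-cycle by adding one new vertex adjacent to all four vertices of the cycle. Let $G$ be a graph on five vertices. Then: (i) if $G\cong K_{2,3}$, then $\chi_{SC}(G)=10$; (ii) if $G\cong K_{2,3}^{+}$, then $\chi_{SC}(G)=11$; (iii) if $G\cong W_4$, then $\chi_{SC}(G)=12$; (iv) otherwise, $G$ is sc-greedy, i.e. $\chi_{SC}(G)=|V(G)|+|E(G)|$.
   Context: Graphs are finite and simple. For a graph $G=(V,E)$, a size function is a map $f:V\to\mathbb{N}$. An $f$-assignment is a map $L:V\to 2^{\mathbb{N}}$ assigning to each vertex $v$ a list (finite set) of colors with $|L(v)|=f(v)$. $G$ is $L$-colorable if there is a proper coloring $c$ of $G$ with $c(v)\in L(v)$ for all $v\in V$. $G$ is $f$-choosable, and $f$ is called a choice function for $G$, if $G$ is $L$-colorable for every $f$-assignment $L$. Put $\operatorname{size}(f)=\sum_{v\in V}f(v)$. The sum choice number $\chi_{SC}(G)$ is the minimum of $\operatorname{size}(f)$ over all choice functions $f$ for $G$. $G$ is sc-greedy if $\chi_{SC}(G)=|V(G)|+|E(G)|$. *)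

theory Defs
  imports Main
begin

record 'a ugraph =
  verts :: "'a set"
  edges :: "'a set set"

definition simple_graph :: "'a ugraph \<Rightarrow> bool" where
  "simple_graph G \<longleftrightarrow>
     finite (verts G) \<and> (\<forall>e\<in>edges G. e \<subseteq> verts G \<and> card e = 2)"

definition graph_iso :: "'a ugraph \<Rightarrow> 'b ugraph \<Rightarrow> bool" where
  "graph_iso G H \<longleftrightarrow>
     (\<exists>\<phi>. bij_betw \<phi> (verts G) (verts H) \<and>
          (\<forall>u\<in>verts G. \<forall>v\<in>verts G. {u, v} \<in> edges G \<longleftrightarrow> {\<phi> u, \<phi> v} \<in> edges H))"

text \<open>Size functions, assignments and colorings are total functions on the vertex type;
  only their values on \<^term>\<open>verts G\<close> matter. The finiteness condition is needed because
  \<^const>\<open>card\<close> is 0 on infinite sets.\<close>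

definition assignment :: "'a ugraph \<Rightarrow> ('a \<Rightarrow> nat) \<Rightarrow> ('a \<Rightarrow> nat set) \<Rightarrow> bool" where
  "assignment G f L \<longleftrightarrow> (\<forall>v\<in>verts G. finite (L v) \<and> card (L v) = f v)"

definition proper_coloring :: "'a ugraph \<Rightarrow> ('a \<Rightarrow> nat) \<Rightarrow> bool" where
  "proper_coloring G c \<longleftrightarrow> (\<forall>u v. {u, v} \<in> edges G \<longrightarrow> c u \<noteq> c v)"

definition list_colorable :: "'a ugraph \<Rightarrow> ('a \<Rightarrow> nat set) \<Rightarrow> bool" where
  "list_colorable G L \<longleftrightarrow> (\<exists>c. proper_coloring G c \<and> (\<forall>v\<in>verts G. c v \<in> L v))"

definition choosable :: "'a ugraph \<Rightarrow> ('a \<Rightarrow> nat) \<Rightarrow> bool" where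
  "choosable G f \<longleftrightarrow> (\<forall>L. assignment G f L \<longrightarrow> list_colorable G L)"

definition fsize :: "'a ugraph \<Rightarrow> ('a \<Rightarrow> nat) \<Rightarrow> nat" where
  "fsize G f = (\<Sum>v\<in>verts G. f v)"

definition sum_choice_number :: "'a ugraph \<Rightarrow> nat" where
  "sum_choice_number G = (LEAST s. \<exists>f. choosable G f \<and> fsize G f = s)"

definition sc_greedy :: "'a ugraph \<Rightarrow> bool" where
  "sc_greedy G \<longleftrightarrow> sum_choice_number G = card (verts G) + card (edges G)"

definition K23 :: "nat ugraph" where
  "K23 = \<lparr>verts = {0, 1, 2, 3, 4}, edges = {{u, v} | u v. u \<in> {0, 1} \<and> v \<in> {2, 3, 4}}\<rparr>"

definition K23_plus :: "nat ugraph" where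
  "K23_plus = \<lparr>verts = verts K23, edges = insert {2, 3} (edges K23)\<rparr>"

definition W4 :: "nat ugraph" where
  "W4 = \<lparr>verts = {0, 1, 2, 3, 4},
         edges = {{0, 1}, {1, 2}, {2, 3}, {3, 0}} \<union> {{4, v} | v. v \<in> {0, 1, 2, 3}}\<rparr>"

end

theory Submission
  imports Defs
begin

text \<open>Colouring greedily along an ordering of the vertices shows that \<open>G\<close> always has a choice
  function of size \<open>|V| + |E|\<close>. So the question is which graphs on five vertices have a smaller one.
  Suppose that \<open>f\<close> is such a smaller choice function and that all graphs \<open>G - v\<close> are sc-greedy.
  Restricting \<open>f\<close> to \<open>G - v\<close> gives \<open>f v \<le> deg v\<close> (\<open>choice_value_upper\<close>). If \<open>f v = 1\<close>, the one
  colour of \<open>v\<close> can be made to cost each neighbour a colour, and lowering \<open>f\<close> by one on the neighbours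
  still gives a choice function of \<open>G - v\<close>, which is too small; hence \<open>f v \<ge> 2\<close>
  (\<open>choice_value_lower\<close>). Call such an \<open>f\<close> deficient. Summing \<open>2 \<le> f v\<close> yields \<open>|E| > |V|\<close>, which
  leaves very dense graphs only.

  On at most four vertices the candidates are \<open>K\<^sub>4\<close> and \<open>K\<^sub>4\<close> minus an edge, and both are refuted by
  the fact that a clique of size \<open>k\<close> cannot be coloured from \<open>k - 1\<close> colours. So all these graphs are
  sc-greedy, and the reduction applies to five vertices, where six to ten edges remain. Besides
  cliques, three bad list assignments on five vertices suffice there:
  \<open>butterfly_obstruction\<close>, \<open>book_obstruction\<close> and \<open>K5_minus_edge_obstruction\<close>. With six
  edges \<open>f\<close> is constantly 2, so \<open>G\<close> is triangle-free and must be \<open>K\<^sub>2\<^sub>,\<^sub>3\<close>; with seven edges at most one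
  vertex has value 3, so it lies on all triangles and \<open>G\<close> must be \<open>K\<^sub>2\<^sub>,\<^sub>3\<close> plus an edge; with eight edges
  \<open>G\<close> is the wheel, since the other graph contains a \<open>K\<^sub>4\<close> that already uses up too much; nine and ten
  edges are impossible.

  For the three exceptional graphs explicit choice functions of size \<open>|V| + |E| - 1\<close> exist
  (\<open>K23_choosable\<close>, \<open>K23_plus_choosable\<close>, \<open>W4_choosable\<close>). No two units can be saved: the bound
  on \<open>f v\<close> becomes \<open>f v \<le> deg v - 1\<close>, which contradicts \<open>f v \<ge> 2\<close> at a vertex of degree 2 and, for the
  wheel, permits only values refuted by the butterfly.\<close>

section \<open>Deleting a vertex\<close>

definition delete_vertex :: "'a \<Rightarrow> 'a ugraph \<Rightarrow> 'a ugraph" where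
  "delete_vertex v G = \<lparr>verts = verts G - {v}, edges = {e \<in> edges G. v \<notin> e}\<rparr>"

definition neighbours :: "'a ugraph \<Rightarrow> 'a \<Rightarrow> 'a set" where
  "neighbours G v = {u. {v, u} \<in> edges G}"

definition greedy_size :: "'a ugraph \<Rightarrow> nat" where
  "greedy_size G = card (verts G) + card (edges G)"

definition greedy_bound :: "'a ugraph \<Rightarrow> bool" where
  "greedy_bound G \<longleftrightarrow> (\<forall>f. choosable G f \<longrightarrow> greedy_size G \<le> fsize G f)"

lemma verts_delete_vertex [simp]: "verts (delete_vertex v G) = verts G - {v}"
  by (simp add: delete_vertex_def)

lemma edges_delete_vertex [simp]: "edges (delete_vertex v G) = {e \<in> edges G. v \<notin> e}"
  by (simp add: delete_vertex_def)

lemma simple_graph_delete_vertex: "simple_graph G \<Longrightarrow> simple_graph (delete_vertex v G)"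
  unfolding simple_graph_def by auto

lemma finite_verts: "simple_graph G \<Longrightarrow> finite (verts G)"
  by (simp add: simple_graph_def)

lemma edgeD:
  assumes "simple_graph G" "{u, v} \<in> edges G"
  shows "u \<in> verts G" "v \<in> verts G" "u \<noteq> v"
proof -
  have "{u, v} \<subseteq> verts G" "card {u, v} = 2"
    using assms unfolding simple_graph_def by blast+
  then show "u \<in> verts G" "v \<in> verts G" "u \<noteq> v" by auto
qed

lemma edges_subset: "simple_graph G \<Longrightarrow> edges G \<subseteq> {e. e \<subseteq> verts G \<and> card e = 2}"
  unfolding simple_graph_def by auto

lemma finite_edges: "simple_graph G \<Longrightarrow> finite (edges G)"
  by (rule finite_subset[OF edges_subset]) (auto simp: finite_verts)

lemma neighbours_subset: "simple_graph G \<Longrightarrow> neighbours G v \<subseteq> verts G - {v}"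
  using edgeD(2,3)[of G v] unfolding neighbours_def by auto

lemma finite_neighbours: "simple_graph G \<Longrightarrow> finite (neighbours G v)"
  by (meson finite_Diff finite_subset finite_verts neighbours_subset)

lemma card_edges_delete_vertex:
  assumes "simple_graph G"
  shows "card (edges G) = card (edges (delete_vertex v G)) + card (neighbours G v)"
proof -
  have "(\<lambda>u. {v, u}) ` neighbours G v = {e \<in> edges G. v \<in> e}"
  proof (intro equalityI subsetI)
    fix e assume e: "e \<in> {e \<in> edges G. v \<in> e}"
    then obtain x y where "e = {x, y}"
      using assms unfolding simple_graph_def by (auto simp: card_2_iff)
    with e show "e \<in> (\<lambda>u. {v, u}) ` neighbours G v"
      by (auto simp: neighbours_def insert_commute)
  qed (auto simp: neighbours_def)
  moreover have "inj_on (\<lambda>u. {v, u}) (neighbours G v)"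
    by (auto simp: inj_on_def doubleton_eq_iff)
  ultimately have "card (neighbours G v) = card {e \<in> edges G. v \<in> e}"
    by (metis card_image)
  moreover have "card (edges G) = card {e \<in> edges G. v \<notin> e} + card {e \<in> edges G. v \<in> e}"
    by (subst card_Un_disjoint[symmetric]) (auto simp: finite_edges[OF assms] intro: arg_cong[of _ _ card])
  ultimately show ?thesis by simp
qed

lemma greedy_size_delete_vertex:
  assumes "simple_graph G" "v \<in> verts G"
  shows "greedy_size G = greedy_size (delete_vertex v G) + card (neighbours G v) + 1"
  using card_edges_delete_vertex[OF assms(1), of v] card_Suc_Diff1[OF finite_verts[OF assms(1)] assms(2)]
  by (simp add: greedy_size_def)

lemma fsize_delete_vertex:
  assumes "simple_graph G" "v \<in> verts G"
  shows "fsize G f = f v + fsize (delete_vertex v G) f"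
  unfolding fsize_def using assms by (simp add: finite_verts sum.remove)

section \<open>Choice functions and deletion\<close>

text \<open>Enlarging lists never hurts, so a bad assignment only needs lists that are at least as long as
  prescribed, and only on the vertices that matter. Choosability is refuted in this form below.\<close>

lemma choosable_larger_lists:
  assumes f: "choosable G f" and S: "S \<subseteq> verts G"
    and L: "\<And>v. v \<in> S \<Longrightarrow> finite (L v) \<and> f v \<le> card (L v)"
  shows "\<exists>c. proper_coloring G c \<and> (\<forall>v\<in>S. c v \<in> L v)"
proof -
  have "\<forall>v. \<exists>M. finite M \<and> card M = f v \<and> (v \<in> S \<longrightarrow> M \<subseteq> L v)"
  proof
    fix v
    show "\<exists>M. finite M \<and> card M = f v \<and> (v \<in> S \<longrightarrow> M \<subseteq> L v)"
    proof (cases "v \<in> S")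
      case True
      then show ?thesis using L[of v] by (metis obtain_subset_with_card_n)
    next
      case False
      then show ?thesis by (intro exI[of _ "{..<f v}"]) auto
    qed
  qed
  then obtain M where M: "\<And>v. finite (M v) \<and> card (M v) = f v \<and> (v \<in> S \<longrightarrow> M v \<subseteq> L v)"
    by metis
  then have "assignment G f M" by (simp add: assignment_def)
  then obtain c where "proper_coloring G c" "\<forall>v\<in>verts G. c v \<in> M v"
    using f unfolding choosable_def list_colorable_def by blast
  with M S show ?thesis by blast
qed

lemma choosable_pos:
  assumes "choosable G f" "v \<in> verts G"
  shows "1 \<le> f v"
proof (rule ccontr)
  assume "\<not> 1 \<le> f v"
  then show False
    using choosable_larger_lists[OF assms(1), of "{v}" "\<lambda>_. {}"] assms(2) by simp
qed

lemma choosable_delete_vertex: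
  assumes "choosable G f"
  shows "choosable (delete_vertex v G) f"
  unfolding choosable_def
proof (intro allI impI)
  fix L assume "assignment (delete_vertex v G) f L"
  then obtain c where "proper_coloring G c" "\<forall>u\<in>verts G - {v}. c u \<in> L u"
    using choosable_larger_lists[OF assms, of "verts G - {v}" L] by (auto simp: assignment_def)
  then show "list_colorable (delete_vertex v G) L"
    unfolding list_colorable_def proper_coloring_def by (intro exI[of _ c]) auto
qed

text \<open>A vertex with a single colour takes that colour away from its neighbours, and an adversary can
  make it a colour that every neighbour would like to use.\<close>

lemma choosable_delete_singleton:
  assumes G: "simple_graph G" and f: "choosable G f" and v: "v \<in> verts G" "f v \<le> 1"
  shows "choosable (delete_vertex v G) (\<lambda>u. f u - (if u \<in> neighbours G v then 1 else 0))"
    (is "choosable ?D ?g")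
  unfolding choosable_def
proof (intro allI impI)
  fix L assume L: "assignment ?D ?g L"
  \<comment> \<open>The colour of \<open>v\<close> has to be new, so that it costs every neighbour exactly one colour.\<close>
  define X where "X = (\<Union>u\<in>verts G - {v}. L u)"
  have "finite X" using L finite_verts[OF G] by (auto simp: X_def assignment_def)
  then obtain a where a: "a \<notin> X" using ex_new_if_finite infinite_UNIV_nat by blast
  define M where "M u = (if u = v then {a} else if u \<in> neighbours G v then insert a (L u) else L u)" for u
  have "finite (M u) \<and> f u \<le> card (M u)" if "u \<in> verts G" for u
  proof (cases "u = v")
    case False
    then have "finite (L u)" "card (L u) = ?g u" "a \<notin> L u"
      using L that a by (auto simp: assignment_def X_def)
    then show ?thesis using False by (auto simp: M_def)
  qed (use v in \<open>simp add: M_def\<close>)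
  then obtain c where c: "proper_coloring G c" "\<And>u. u \<in> verts G \<Longrightarrow> c u \<in> M u"
    using choosable_larger_lists[OF f, of "verts G" M] by auto
  have "c v = a" using c(2)[OF v(1)] by (simp add: M_def)
  moreover have "c u \<noteq> c v" if "u \<in> neighbours G v" for u
    using c(1) that by (metis insert_commute mem_Collect_eq neighbours_def proper_coloring_def)
  ultimately have "\<forall>u\<in>verts G - {v}. c u \<in> L u"
    using c(2) by (fastforce simp: M_def split: if_splits)
  with c(1) show "list_colorable ?D L"
    unfolding list_colorable_def proper_coloring_def by (intro exI[of _ c]) auto
qed

text \<open>A list longer than the degree always leaves a colour for the vertex coloured last.\<close>

lemma choosable_extend:
  assumes G: "simple_graph G" and v: "v \<in> verts G" and f: "choosable (delete_vertex v G) f"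
  shows "choosable G (f(v := card (neighbours G v) + 1))" (is "choosable G ?g")
  unfolding choosable_def
proof (intro allI impI)
  fix L assume L: "assignment G ?g L"
  then have "assignment (delete_vertex v G) f L" by (auto simp: assignment_def)
  then obtain c where c: "proper_coloring (delete_vertex v G) c" "\<forall>u\<in>verts G - {v}. c u \<in> L u"
    using f by (auto simp: choosable_def list_colorable_def)
  have "card (c ` neighbours G v) < card (L v)"
    using L v card_image_le[OF finite_neighbours[OF G], of c v] by (auto simp: assignment_def)
  moreover have "finite (c ` neighbours G v)" by (simp add: finite_neighbours[OF G])
  ultimately obtain a where a: "a \<in> L v" "a \<notin> c ` neighbours G v"
    by (meson card_mono not_le subsetI)
  have "proper_coloring G (c(v := a))"
    unfolding proper_coloring_def
  proof (intro allI impI)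
    fix x y assume e: "{x, y} \<in> edges G"
    then have "x \<noteq> y" using edgeD[OF G] by blast
    then consider "x = v" "y \<noteq> v" | "y = v" "x \<noteq> v" | "x \<noteq> v" "y \<noteq> v" by blast
    then show "(c(v := a)) x \<noteq> (c(v := a)) y"
    proof cases
      case 3
      then show ?thesis using e c(1) by (simp add: proper_coloring_def)
    qed (use a(2) e in \<open>auto simp: neighbours_def insert_commute\<close>)
  qed
  then show "list_colorable G L"
    unfolding list_colorable_def using c(2) a(1) by (intro exI[of _ "c(v := a)"]) auto
qed

lemma greedy_choice_function:
  assumes "simple_graph G"
  shows "\<exists>f. choosable G f \<and> fsize G f = greedy_size G"
  using assms
proof (induction "card (verts G)" arbitrary: G)
  case 0
  then have V: "verts G = {}" using finite_verts[OF 0(2)] by simp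
  then have "edges G = {}" using edges_subset[OF 0(2)] by auto
  with V show ?case
    by (simp add: choosable_def list_colorable_def proper_coloring_def fsize_def greedy_size_def)
next
  case (Suc n)
  then obtain v where v: "v \<in> verts G" by fastforce
  then have "n = card (verts (delete_vertex v G))" using Suc(2) finite_verts[OF Suc(3)] by simp
  then obtain f where f: "choosable (delete_vertex v G) f"
      "fsize (delete_vertex v G) f = greedy_size (delete_vertex v G)"
    using Suc(1) simple_graph_delete_vertex[OF Suc(3)] by blast
  let ?g = "f(v := card (neighbours G v) + 1)"
  have "fsize (delete_vertex v G) ?g = fsize (delete_vertex v G) f"
    by (auto simp: fsize_def intro: sum.cong)
  then have "fsize G ?g = greedy_size G"
    using fsize_delete_vertex[OF Suc(3) v, of ?g] greedy_size_delete_vertex[OF Suc(3) v] f(2) by simp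
  then show ?case using choosable_extend[OF Suc(3) v f(1)] by blast
qed

lemma sum_choice_number_eqI:
  assumes "choosable G f" "fsize G f = s" "\<And>g. choosable G g \<Longrightarrow> s \<le> fsize G g"
  shows "sum_choice_number G = s"
  unfolding sum_choice_number_def using assms by (intro Least_equality) auto

text \<open>The rest of the graph already costs \<open>greedy_size (delete_vertex v G)\<close>, so a saving on the whole
  graph has to be made at \<open>v\<close> itself. The bound is kept in additive form because the exceptional graphs
  need it for a saving of two.\<close>

lemma choice_value_upper:
  assumes "simple_graph G" "greedy_bound (delete_vertex v G)" "v \<in> verts G" "choosable G f"
  shows "f v + greedy_size G \<le> fsize G f + card (neighbours G v) + 1"
  using assms greedy_size_delete_vertex[OF assms(1,3)] fsize_delete_vertex[OF assms(1,3), of f]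
    choosable_delete_vertex[OF assms(4), of v]
  unfolding greedy_bound_def by fastforce

lemma choice_value_lower:
  assumes G: "simple_graph G" and bound: "greedy_bound (delete_vertex v G)" and v: "v \<in> verts G"
    and f: "choosable G f" and less: "fsize G f < greedy_size G"
  shows "2 \<le> f v"
proof (rule ccontr)
  assume "\<not> 2 \<le> f v"
  then have f1: "f v \<le> 1" by simp
  let ?N = "neighbours G v"
  let ?g = "\<lambda>u. f u - (if u \<in> ?N then 1 else 0)"
  have "greedy_size (delete_vertex v G) \<le> fsize (delete_vertex v G) ?g"
    using bound choosable_delete_singleton[OF G f v f1] by (simp add: greedy_bound_def)
  also have "\<dots> + card ?N = fsize (delete_vertex v G) f"
  proof -
    have "card ?N = (\<Sum>u\<in>verts G - {v}. if u \<in> ?N then 1 else 0)"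
      using neighbours_subset[OF G, of v] finite_verts[OF G]
      by (simp add: sum.If_cases Int_absorb1)
    then have "fsize (delete_vertex v G) ?g + card ?N
        = (\<Sum>u\<in>verts G - {v}. ?g u + (if u \<in> ?N then 1 else 0))"
      by (simp add: fsize_def sum.distrib)
    also have "\<dots> = (\<Sum>u\<in>verts G - {v}. f u)"
      by (rule sum.cong) (use choosable_pos[OF f] in auto)
    finally show ?thesis by (simp add: fsize_def)
  qed
  finally have "greedy_size (delete_vertex v G) + card ?N \<le> fsize (delete_vertex v G) f" by simp
  then show False
    using less choosable_pos[OF f v] greedy_size_delete_vertex[OF G v] fsize_delete_vertex[OF G v, of f]
    by simp
qed

section \<open>Obstructions to choosability\<close>

text \<open>Giving all vertices of the clique the same \<open>card S - 1\<close> colours leaves too few for pairwise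
  distinct values.\<close>

lemma choosable_clique:
  assumes f: "choosable G f" and S: "finite S" "S \<noteq> {}" "S \<subseteq> verts G"
    and clique: "\<And>u v. u \<in> S \<Longrightarrow> v \<in> S \<Longrightarrow> u \<noteq> v \<Longrightarrow> {u, v} \<in> edges G"
  shows "\<exists>v\<in>S. card S \<le> f v"
proof (rule ccontr)
  assume "\<not> ?thesis"
  then have "\<And>v. v \<in> S \<Longrightarrow> f v \<le> card S - 1" by fastforce
  then obtain c where c: "proper_coloring G c" "\<And>v. v \<in> S \<Longrightarrow> c v < card S - 1"
    using choosable_larger_lists[OF f S(3), of "\<lambda>_. {..<card S - 1}"] by auto
  have "inj_on c S" using c(1) clique unfolding proper_coloring_def inj_on_def by blast
  moreover have "c ` S \<subseteq> {..<card S - 1}" using c(2) by auto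
  ultimately have "card S \<le> card S - 1" by (metis card_image card_lessThan card_mono finite_lessThan)
  moreover have "card S > 0" using S by (simp add: card_gt_0_iff)
  ultimately show False by linarith
qed

lemma choosable_triangle:
  assumes "simple_graph G" "choosable G f" "{a, b} \<in> edges G" "{a, c} \<in> edges G" "{b, c} \<in> edges G"
  shows "3 \<le> f a \<or> 3 \<le> f b \<or> 3 \<le> f c"
proof -
  have "a \<noteq> b" "a \<noteq> c" "b \<noteq> c" "{a, b, c} \<subseteq> verts G" using assms edgeD[of G] by auto
  moreover have "{u, v} \<in> edges G" if "u \<in> {a, b, c}" "v \<in> {a, b, c}" "u \<noteq> v" for u v
    using that assms(3-5) by (auto simp: insert_commute)
  ultimately show ?thesis using choosable_clique[OF assms(2), of "{a, b, c}"] by auto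
qed

lemma choosable_K4:
  assumes "simple_graph G" "choosable G f" "{a, b} \<in> edges G" "{a, c} \<in> edges G" "{b, c} \<in> edges G"
    "{a, d} \<in> edges G" "{b, d} \<in> edges G" "{c, d} \<in> edges G"
  shows "4 \<le> f a \<or> 4 \<le> f b \<or> 4 \<le> f c \<or> 4 \<le> f d"
proof -
  have "distinct [a, b, c, d]" "{a, b, c, d} \<subseteq> verts G" using assms edgeD[of G] by auto
  moreover have "{u, v} \<in> edges G" if "u \<in> {a, b, c, d}" "v \<in> {a, b, c, d}" "u \<noteq> v" for u v
    using that assms(3-8) by (auto simp: insert_commute)
  ultimately show ?thesis using choosable_clique[OF assms(2), of "{a, b, c, d}"] by auto
qed

text \<open>Each of the two edges opposite to \<open>h\<close> gets a list of two colours, used twice, so its ends consume both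
  colours. With disjoint lists on the two edges, four colours are blocked at \<open>h\<close>.\<close>

lemma butterfly_obstruction:
  assumes G: "simple_graph G" and f: "choosable G f"
    and e: "{a, b} \<in> edges G" "{c, d} \<in> edges G"
      "{h, a} \<in> edges G" "{h, b} \<in> edges G" "{h, c} \<in> edges G" "{h, d} \<in> edges G"
    and dist: "distinct [h, a, b, c, d]"
    and le: "f a \<le> 2" "f b \<le> 2" "f c \<le> 2" "f d \<le> 2"
  shows "5 \<le> f h"
proof (rule ccontr)
  assume "\<not> 5 \<le> f h"
  then have h: "f h \<le> 4" by simp
  define L :: "'a \<Rightarrow> nat set" where
    "L v = (if v = h then {0, 1, 2, 3} else if v = a \<or> v = b then {0, 1} else {2, 3})" for v
  have V: "{h, a, b, c, d} \<subseteq> verts G" using e edgeD[OF G] by auto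
  have "finite (L w) \<and> f w \<le> card (L w)" if "w \<in> {h, a, b, c, d}" for w
    using that le h dist by (auto simp: L_def)
  then obtain k where k: "proper_coloring G k" "\<forall>w\<in>{h, a, b, c, d}. k w \<in> L w"
    using choosable_larger_lists[OF f V, of L] by blast
  have "k h \<in> {0, 1, 2, 3}" "k a \<in> {0, 1}" "k b \<in> {0, 1}" "k c \<in> {2, 3}" "k d \<in> {2, 3}"
    using k(2) dist by (auto simp: L_def)
  moreover have "k a \<noteq> k b" "k c \<noteq> k d" "k h \<noteq> k a" "k h \<noteq> k b" "k h \<noteq> k c" "k h \<noteq> k d"
    using k(1) e unfolding proper_coloring_def by blast+
  ultimately show False by auto
qed

text \<open>The ends of the spine \<open>uv\<close> use some pair of colours from \<open>{0, 1, 2}\<close>, and each of the three pairs is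
  the list of some page \<open>x\<close>, \<open>y\<close> or \<open>z\<close>.\<close>

lemma book_obstruction:
  assumes G: "simple_graph G" and f: "choosable G f"
    and e: "{u, v} \<in> edges G" "{u, x} \<in> edges G" "{u, y} \<in> edges G" "{u, z} \<in> edges G"
      "{v, x} \<in> edges G" "{v, y} \<in> edges G" "{v, z} \<in> edges G"
    and dist: "distinct [u, v, x, y, z]"
    and le: "f v \<le> 2" "f x \<le> 2" "f y \<le> 2" "f z \<le> 2"
  shows "4 \<le> f u"
proof (rule ccontr)
  assume "\<not> 4 \<le> f u"
  then have u: "f u \<le> 3" by simp
  define L :: "'a \<Rightarrow> nat set" where
    "L w = (if w = u then {0, 1, 2} else if w = v \<or> w = x then {0, 1}
      else if w = y then {0, 2} else {1, 2})" for w
  have V: "{u, v, x, y, z} \<subseteq> verts G" using e edgeD[OF G] by auto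
  have "finite (L w) \<and> f w \<le> card (L w)" if "w \<in> {u, v, x, y, z}" for w
    using that le u dist by (auto simp: L_def)
  then obtain k where k: "proper_coloring G k" "\<forall>w\<in>{u, v, x, y, z}. k w \<in> L w"
    using choosable_larger_lists[OF f V, of L] by blast
  have "k u \<in> {0, 1, 2}" "k v \<in> {0, 1}" "k x \<in> {0, 1}" "k y \<in> {0, 2}" "k z \<in> {1, 2}"
    using k(2) dist by (auto simp: L_def)
  moreover have "k u \<noteq> k v" "k u \<noteq> k x" "k u \<noteq> k y" "k u \<noteq> k z" "k v \<noteq> k x" "k v \<noteq> k y" "k v \<noteq> k z"
    using k(1) e unfolding proper_coloring_def by blast+
  ultimately show False by auto
qed

text \<open>The triangle \<open>cde\<close> uses three of the four colours, hence all of \<open>{0, 1}\<close> or all of \<open>{2, 3}\<close>. These are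
  the lists of \<open>a\<close> and \<open>b\<close>, which are adjacent to the whole triangle.\<close>

lemma K5_minus_edge_obstruction:
  assumes G: "simple_graph G" and f: "choosable G f"
    and e: "{c, d} \<in> edges G" "{c, e} \<in> edges G" "{d, e} \<in> edges G"
      "{a, c} \<in> edges G" "{a, d} \<in> edges G" "{a, e} \<in> edges G"
      "{b, c} \<in> edges G" "{b, d} \<in> edges G" "{b, e} \<in> edges G"
    and dist: "distinct [a, b, c, d, e]"
    and le: "f a \<le> 2" "f b \<le> 2" "f c \<le> 2" "f d \<le> 3"
  shows "5 \<le> f e"
proof (rule ccontr)
  assume "\<not> 5 \<le> f e"
  then have u: "f e \<le> 4" by simp
  define L :: "'a \<Rightarrow> nat set" where
    "L w = (if w = e then {0, 1, 2, 3} else if w = d then {0, 1, 2}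
      else if w = b then {2, 3} else {0, 1})" for w
  have V: "{a, b, c, d, e} \<subseteq> verts G" using e edgeD[OF G] by auto
  have "finite (L w) \<and> f w \<le> card (L w)" if "w \<in> {a, b, c, d, e}" for w
    using that le u dist by (auto simp: L_def)
  then obtain k where k: "proper_coloring G k" "\<forall>w\<in>{a, b, c, d, e}. k w \<in> L w"
    using choosable_larger_lists[OF f V, of L] by blast
  have "k e \<in> {0, 1, 2, 3}" "k d \<in> {0, 1, 2}" "k c \<in> {0, 1}" "k a \<in> {0, 1}" "k b \<in> {2, 3}"
    using k(2) dist by (auto simp: L_def)
  moreover have "k c \<noteq> k d" "k c \<noteq> k e" "k d \<noteq> k e" "k a \<noteq> k c" "k a \<noteq> k d" "k a \<noteq> k e"
    "k b \<noteq> k c" "k b \<noteq> k d" "k b \<noteq> k e"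
    using k(1) e unfolding proper_coloring_def by blast+
  ultimately show False by auto
qed

section \<open>Deficient choice functions and graphs on at most four vertices\<close>

text \<open>A choice function that beats the greedy one although no vertex-deleted subgraph allows this. The
  classification below is about which graphs have one.\<close>

definition deficient :: "'a ugraph \<Rightarrow> ('a \<Rightarrow> nat) \<Rightarrow> bool" where
  "deficient G f \<longleftrightarrow> simple_graph G \<and> choosable G f \<and> fsize G f < greedy_size G \<and>
     (\<forall>v\<in>verts G. greedy_bound (delete_vertex v G))"

lemma deficient_ge_2: "deficient G f \<Longrightarrow> v \<in> verts G \<Longrightarrow> 2 \<le> f v"
  using choice_value_lower[of G v f] by (simp add: deficient_def)

lemma deficient_le_degree: "deficient G f \<Longrightarrow> v \<in> verts G \<Longrightarrow> f v \<le> card (neighbours G v)"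
  using choice_value_upper[of G v f] by (simp add: deficient_def)

lemma deficient_degree_ge_2: "deficient G f \<Longrightarrow> v \<in> verts G \<Longrightarrow> 2 \<le> card (neighbours G v)"
  using deficient_ge_2[of G f v] deficient_le_degree[of G f v] by simp

lemma deficient_card_edges:
  assumes "deficient G f"
  shows "card (verts G) < card (edges G)"
proof -
  have "2 * card (verts G) \<le> fsize G f"
    unfolding fsize_def using sum_mono[of "verts G" "\<lambda>_. 2" f] deficient_ge_2[OF assms] by simp
  then show ?thesis using assms by (simp add: deficient_def greedy_size_def)
qed

definition nonedges :: "'a ugraph \<Rightarrow> 'a set set" where
  "nonedges G = {e. e \<subseteq> verts G \<and> card e = 2} - edges G"

lemma edge_iff_not_nonedge:
  "u \<in> verts G \<Longrightarrow> v \<in> verts G \<Longrightarrow> u \<noteq> v \<Longrightarrow> {u, v} \<in> edges G \<longleftrightarrow> {u, v} \<notin> nonedges G"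
  by (auto simp: nonedges_def)

lemma nonedgeE:
  assumes "e \<in> nonedges G"
  obtains a b where "e = {a, b}" "a \<noteq> b" "a \<in> verts G" "b \<in> verts G" "{a, b} \<notin> edges G"
  using assms by (auto simp: nonedges_def card_2_iff)

lemma finite_nonedges: "simple_graph G \<Longrightarrow> finite (nonedges G)"
  unfolding nonedges_def by (auto dest: finite_verts)

lemma card_edges_nonedges:
  assumes "simple_graph G"
  shows "card (edges G) + card (nonedges G) = card (verts G) choose 2"
proof -
  let ?P = "{e. e \<subseteq> verts G \<and> card e = 2}"
  have "finite ?P" using finite_verts[OF assms] by simp
  then have "card ?P = card (edges G) + card (?P - edges G)"
    using card_mono[OF _ edges_subset[OF assms]] card_Diff_subset[OF finite_edges edges_subset] assms
    by fastforce
  then show ?thesis using n_subsets[OF finite_verts[OF assms], of 2] by (simp add: nonedges_def)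
qed

text \<open>By the clique bound some vertex would have a value of at least \<open>|V|\<close>, more than its degree.\<close>

lemma deficient_not_complete:
  assumes "deficient G f"
  shows "nonedges G \<noteq> {}"
proof
  assume N: "nonedges G = {}"
  have G: "simple_graph G" and f: "choosable G f" using assms by (auto simp: deficient_def)
  have "edges G \<noteq> {}" using deficient_card_edges[OF assms] by auto
  then have "verts G \<noteq> {}" using edges_subset[OF G] by fastforce
  then obtain v where v: "v \<in> verts G" "card (verts G) \<le> f v"
    using choosable_clique[OF f finite_verts[OF G]] edge_iff_not_nonedge[of _ G] N by auto
  have "f v \<le> card (verts G - {v})"
    using deficient_le_degree[OF assms v(1)] neighbours_subset[OF G, of v] finite_verts[OF G]
    by (meson card_mono finite_Diff order_trans)
  also have "\<dots> < card (verts G)" using v(1) finite_verts[OF G] by (meson card_Diff1_less)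
  finally show False using v(2) by simp
qed

text \<open>More edges than vertices, but not all of them, is possible only for \<open>K\<^sub>4\<close> minus an edge. There the
  smaller size forces value 2 everywhere, and a triangle remains.\<close>

lemma greedy_bound_le_four_vertices:
  assumes "simple_graph G" "card (verts G) \<le> 4"
  shows "greedy_bound G"
  using assms
proof (induction "card (verts G)" arbitrary: G rule: less_induct)
  case less
  note G = less.prems(1)
  show ?case
  proof (rule ccontr)
    assume "\<not> greedy_bound G"
    then obtain f where f: "choosable G f" "fsize G f < greedy_size G"
      by (auto simp: greedy_bound_def not_le)
    have "greedy_bound (delete_vertex v G)" if "v \<in> verts G" for v
    proof (rule less.hyps)
      show "card (verts (delete_vertex v G)) < card (verts G)"
        using that finite_verts[OF G] by (simp add: card_Diff1_less del: card_Diff_insert)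
      then show "card (verts (delete_vertex v G)) \<le> 4" using less.prems(2) by linarith
    qed (rule simple_graph_delete_vertex[OF G])
    then have D: "deficient G f" using G f by (simp add: deficient_def)
    have "card (nonedges G) > 0"
      using deficient_not_complete[OF D] finite_nonedges[OF G] by (simp add: card_gt_0_iff)
    moreover have "card (verts G) \<in> {0, 1, 2, 3, 4}" using less.prems(2) by auto
    ultimately have n: "card (verts G) = 4" and m: "card (edges G) = 5" and N: "card (nonedges G) = 1"
      using deficient_card_edges[OF D] card_edges_nonedges[OF G] by (auto simp: choose_two)
    obtain e where e: "nonedges G = {e}" using N by (auto simp: card_1_singleton_iff)
    then obtain a b where ab: "e = {a, b}" "a \<noteq> b" "a \<in> verts G" "b \<in> verts G"
      by (metis insertI1 nonedgeE)
    have "card (verts G - {a, b}) = 2" using n ab finite_verts[OF G] by (simp add: card_Diff_subset)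
    then obtain c d where cd: "verts G - {a, b} = {c, d}" "c \<noteq> d" by (auto simp: card_2_iff)
    have V: "verts G = {a, b, c, d}" using cd(1) ab by auto
    have dist: "distinct [a, b, c, d]" using cd ab by auto
    have "{a, c} \<in> edges G" "{a, d} \<in> edges G" "{c, d} \<in> edges G"
      using dist by (auto simp: V edge_iff_not_nonedge e ab doubleton_eq_iff)
    then have "3 \<le> f a \<or> 3 \<le> f c \<or> 3 \<le> f d" using choosable_triangle[OF G f(1)] by blast
    moreover have "f a + f b + f c + f d < 9"
      using f(2) dist n m by (simp add: fsize_def greedy_size_def V)
    ultimately show False
      using deficient_ge_2[OF D, of a] deficient_ge_2[OF D, of b] deficient_ge_2[OF D, of c]
        deficient_ge_2[OF D, of d] by (auto simp: V)
  qed
qed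

section \<open>Counting edges on five vertices\<close>

lemma degree_eq_sum_list:
  assumes "simple_graph G" "verts G \<subseteq> insert v (set xs)" "distinct xs"
  shows "card (neighbours G v) = (\<Sum>x\<leftarrow>xs. of_bool ({v, x} \<in> edges G))"
proof -
  have "neighbours G v = set xs \<inter> {x. {v, x} \<in> edges G}"
    using neighbours_subset[OF assms(1), of v] assms(2) by (auto simp: neighbours_def)
  then have "card (neighbours G v) = (\<Sum>x\<in>set xs. of_bool ({v, x} \<in> edges G))"
    by (simp add: sum_of_bool_eq)
  then show ?thesis by (simp only: sum.distinct_set_conv_list[OF assms(3)])
qed

lemma degree_five:
  assumes "simple_graph G" "verts G = {a, b, c, d, e}" "distinct [a, b, c, d, e]"
  shows "card (neighbours G a) = of_bool ({a, b} \<in> edges G) + of_bool ({a, c} \<in> edges G)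
    + of_bool ({a, d} \<in> edges G) + of_bool ({a, e} \<in> edges G)"
  using degree_eq_sum_list[OF assms(1), of a "[b, c, d, e]"] assms(2,3) by simp

lemma card_edges_five:
  assumes G: "simple_graph G" and V: "verts G = {a, b, c, d, e}" and dist: "distinct [a, b, c, d, e]"
  shows "card (edges G) = of_bool ({a, b} \<in> edges G) + of_bool ({a, c} \<in> edges G)
    + of_bool ({a, d} \<in> edges G) + of_bool ({a, e} \<in> edges G) + of_bool ({b, c} \<in> edges G)
    + of_bool ({b, d} \<in> edges G) + of_bool ({b, e} \<in> edges G) + of_bool ({c, d} \<in> edges G)
    + of_bool ({c, e} \<in> edges G) + of_bool ({d, e} \<in> edges G)"
proof -
  define A where "A = delete_vertex a G"
  define B where "B = delete_vertex b A"
  define C where "C = delete_vertex c B"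
  define D where "D = delete_vertex d C"
  have simple: "simple_graph A" "simple_graph B" "simple_graph C" "simple_graph D"
    by (simp_all add: A_def B_def C_def D_def simple_graph_delete_vertex G)
  have verts: "verts A = {b, c, d, e}" "verts B = {c, d, e}" "verts C = {d, e}" "verts D = {e}"
    using V dist unfolding A_def B_def C_def D_def by auto
  have "card (edges D) = 0"
    using card_edges_nonedges[OF simple(4)] verts(4) by (simp add: choose_two)
  moreover have "card (edges G) = card (edges A) + card (neighbours G a)"
    unfolding A_def by (rule card_edges_delete_vertex[OF G])
  moreover have "card (edges A) = card (edges B) + card (neighbours A b)"
    unfolding B_def by (rule card_edges_delete_vertex[OF simple(1)])
  moreover have "card (edges B) = card (edges C) + card (neighbours B c)"
    unfolding C_def by (rule card_edges_delete_vertex[OF simple(2)])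
  moreover have "card (edges C) = card (edges D) + card (neighbours C d)"
    unfolding D_def by (rule card_edges_delete_vertex[OF simple(3)])
  ultimately have "card (edges G) = card (neighbours G a) + card (neighbours A b)
      + card (neighbours B c) + card (neighbours C d)"
    by linarith
  also have "card (neighbours A b) = of_bool ({b, c} \<in> edges G) + of_bool ({b, d} \<in> edges G)
      + of_bool ({b, e} \<in> edges G)"
    using degree_eq_sum_list[OF simple(1), of b "[c, d, e]"] verts dist by (simp add: A_def)
  also have "card (neighbours B c) = of_bool ({c, d} \<in> edges G) + of_bool ({c, e} \<in> edges G)"
    using degree_eq_sum_list[OF simple(2), of c "[d, e]"] verts dist by (simp add: A_def B_def)
  also have "card (neighbours C d) = of_bool ({d, e} \<in> edges G)"
    using degree_eq_sum_list[OF simple(3), of d "[e]"] verts dist by (simp add: A_def B_def C_def)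
  finally show ?thesis using degree_five[OF G V dist] by simp
qed

section \<open>Isomorphism with a labelled graph\<close>

lemma graph_iso_iff_list:
  assumes H: "verts H = {..<n}"
  shows "graph_iso G H \<longleftrightarrow> (\<exists>xs. length xs = n \<and> distinct xs \<and> set xs = verts G \<and>
    (\<forall>i<n. \<forall>j<n. {xs ! i, xs ! j} \<in> edges G \<longleftrightarrow> {i, j} \<in> edges H))" (is "_ \<longleftrightarrow> (\<exists>xs. ?P xs)")
proof
  assume "graph_iso G H"
  then obtain \<phi> where \<phi>: "bij_betw \<phi> (verts G) {..<n}"
    and adj: "\<And>u v. u \<in> verts G \<Longrightarrow> v \<in> verts G \<Longrightarrow> {u, v} \<in> edges G \<longleftrightarrow> {\<phi> u, \<phi> v} \<in> edges H"
    by (auto simp: graph_iso_def H)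
  define g where "g = inv_into (verts G) \<phi>"
  have g: "bij_betw g {..<n} (verts G)" unfolding g_def by (rule bij_betw_inv_into[OF \<phi>])
  have \<phi>g: "\<phi> (g i) = i" "g i \<in> verts G" if "i < n" for i
    using that bij_betw_inv_into_right[OF \<phi>, of i] bij_betwE[OF g] by (auto simp: g_def)
  have "?P (map g [0..<n])"
    using g adj \<phi>g by (auto simp: bij_betw_def distinct_map atLeast0LessThan)
  then show "\<exists>xs. ?P xs" by blast
next
  assume "\<exists>xs. ?P xs"
  then obtain xs where xs: "?P xs" by blast
  have nth: "bij_betw ((!) xs) {..<n} (verts G)"
    using xs by (intro bij_betw_nth) auto
  define \<phi> where "\<phi> = inv_into {..<n} ((!) xs)"
  have \<phi>: "bij_betw \<phi> (verts G) {..<n}" unfolding \<phi>_def by (rule bij_betw_inv_into[OF nth])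
  have "xs ! \<phi> u = u" "\<phi> u < n" if "u \<in> verts G" for u
    using that bij_betw_inv_into_right[OF nth, of u] bij_betwE[OF \<phi>] by (auto simp: \<phi>_def)
  then have "\<forall>u\<in>verts G. \<forall>v\<in>verts G. {u, v} \<in> edges G \<longleftrightarrow> {\<phi> u, \<phi> v} \<in> edges H"
    using xs by metis
  with \<phi> show "graph_iso G H" by (auto simp: graph_iso_def H)
qed

lemma all_less_five: "(\<forall>i<5. P i) \<longleftrightarrow> P 0 \<and> P 1 \<and> P 2 \<and> P 3 \<and> P (4::nat)"
  by (auto simp: numeral_eq_Suc less_Suc_eq)

lemma all_pairs_less_five:
  fixes P :: "nat \<Rightarrow> nat \<Rightarrow> bool"
  assumes "\<And>i. P i i" "\<And>i j. P i j \<longleftrightarrow> P j i"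
  shows "(\<forall>i<5. \<forall>j<5. P i j) \<longleftrightarrow> P 0 1 \<and> P 0 2 \<and> P 0 3 \<and> P 0 4 \<and> P 1 2 \<and> P 1 3 \<and> P 1 4
    \<and> P 2 3 \<and> P 2 4 \<and> P 3 4"
  unfolding all_less_five using assms by blast

text \<open>The list form of an isomorphism is turned into five named vertices, so that the ten adjacencies
  become explicit.\<close>

lemma ex_list_length_five: "(\<exists>xs. length xs = 5 \<and> R xs) \<longleftrightarrow> (\<exists>a b c d e. R [a, b, c, d, e])"
proof
  assume "\<exists>xs. length xs = 5 \<and> R xs"
  then obtain xs where "length xs = 5" "R xs" by blast
  moreover from this obtain a b c d e where "xs = [a, b, c, d, e]"
    by (auto simp: numeral_eq_Suc length_Suc_conv)
  ultimately show "\<exists>a b c d e. R [a, b, c, d, e]" by blast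
next
  assume "\<exists>a b c d e. R [a, b, c, d, e]"
  then obtain a b c d e where "R [a, b, c, d, e]" by blast
  then show "\<exists>xs. length xs = 5 \<and> R xs" by (intro exI[of _ "[a, b, c, d, e]"]) simp
qed

lemma graph_iso_five:
  fixes H :: "nat ugraph"
  assumes G: "simple_graph G" and H: "simple_graph H" "verts H = {0, 1, 2, 3, 4}"
  shows "graph_iso G H \<longleftrightarrow> (\<exists>a b c d e. distinct [a, b, c, d, e] \<and> verts G = {a, b, c, d, e} \<and>
    ({a, b} \<in> edges G \<longleftrightarrow> {0, 1} \<in> edges H) \<and> ({a, c} \<in> edges G \<longleftrightarrow> {0, 2} \<in> edges H) \<and>
    ({a, d} \<in> edges G \<longleftrightarrow> {0, 3} \<in> edges H) \<and> ({a, e} \<in> edges G \<longleftrightarrow> {0, 4} \<in> edges H) \<and>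
    ({b, c} \<in> edges G \<longleftrightarrow> {1, 2} \<in> edges H) \<and> ({b, d} \<in> edges G \<longleftrightarrow> {1, 3} \<in> edges H) \<and>
    ({b, e} \<in> edges G \<longleftrightarrow> {1, 4} \<in> edges H) \<and> ({c, d} \<in> edges G \<longleftrightarrow> {2, 3} \<in> edges H) \<and>
    ({c, e} \<in> edges G \<longleftrightarrow> {2, 4} \<in> edges H) \<and> ({d, e} \<in> edges G \<longleftrightarrow> {3, 4} \<in> edges H))"
proof -
  have loopless: "{x} \<notin> edges G" "{i} \<notin> edges H" for x i
    using G H by (auto simp: simple_graph_def)
  have "verts H = {..<5}" using H(2) by auto
  then have "graph_iso G H \<longleftrightarrow> (\<exists>xs. length xs = 5 \<and> distinct xs \<and> set xs = verts G \<and>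
      (\<forall>i<5. \<forall>j<5. {xs ! i, xs ! j} \<in> edges G \<longleftrightarrow> {i, j} \<in> edges H))"
    by (rule graph_iso_iff_list)
  also have "\<dots> \<longleftrightarrow> (\<exists>a b c d e. distinct [a, b, c, d, e] \<and> set [a, b, c, d, e] = verts G \<and>
      (\<forall>i<5. \<forall>j<5. {[a, b, c, d, e] ! i, [a, b, c, d, e] ! j} \<in> edges G \<longleftrightarrow> {i, j} \<in> edges H))"
    by (rule ex_list_length_five)
  also have "\<dots> \<longleftrightarrow> (\<exists>a b c d e. distinct [a, b, c, d, e] \<and> set [a, b, c, d, e] = verts G \<and>
    ({a, b} \<in> edges G \<longleftrightarrow> {0, 1} \<in> edges H) \<and> ({a, c} \<in> edges G \<longleftrightarrow> {0, 2} \<in> edges H) \<and>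
    ({a, d} \<in> edges G \<longleftrightarrow> {0, 3} \<in> edges H) \<and> ({a, e} \<in> edges G \<longleftrightarrow> {0, 4} \<in> edges H) \<and>
    ({b, c} \<in> edges G \<longleftrightarrow> {1, 2} \<in> edges H) \<and> ({b, d} \<in> edges G \<longleftrightarrow> {1, 3} \<in> edges H) \<and>
    ({b, e} \<in> edges G \<longleftrightarrow> {1, 4} \<in> edges H) \<and> ({c, d} \<in> edges G \<longleftrightarrow> {2, 3} \<in> edges H) \<and>
    ({c, e} \<in> edges G \<longleftrightarrow> {2, 4} \<in> edges H) \<and> ({d, e} \<in> edges G \<longleftrightarrow> {3, 4} \<in> edges H))"
    by (subst all_pairs_less_five) (simp_all add: loopless insert_commute numeral_eq_Suc)
  finally show ?thesis by (simp only: list.set eq_commute[of _ "verts G"])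
qed

lemma simple_K23: "simple_graph K23" "verts K23 = {0, 1, 2, 3, 4}"
  by (auto simp: simple_graph_def K23_def)

lemma simple_K23_plus: "simple_graph K23_plus" "verts K23_plus = {0, 1, 2, 3, 4}"
  by (auto simp: simple_graph_def K23_plus_def K23_def)

lemma simple_W4: "simple_graph W4" "verts W4 = {0, 1, 2, 3, 4}"
  by (auto simp: simple_graph_def W4_def)

lemma graph_iso_K23:
  assumes "simple_graph G"
  shows "graph_iso G K23 \<longleftrightarrow> (\<exists>x y p q r. distinct [x, y, p, q, r] \<and> verts G = {x, y, p, q, r} \<and>
    {x, y} \<notin> edges G \<and> {x, p} \<in> edges G \<and> {x, q} \<in> edges G \<and> {x, r} \<in> edges G \<and>
    {y, p} \<in> edges G \<and> {y, q} \<in> edges G \<and> {y, r} \<in> edges G \<and>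
    {p, q} \<notin> edges G \<and> {p, r} \<notin> edges G \<and> {q, r} \<notin> edges G)"
proof -
  have "{0, 1} \<notin> edges K23" "{0, 2} \<in> edges K23" "{0, 3} \<in> edges K23" "{0, 4} \<in> edges K23"
    "{1, 2} \<in> edges K23" "{1, 3} \<in> edges K23" "{1, 4} \<in> edges K23"
    "{2, 3} \<notin> edges K23" "{2, 4} \<notin> edges K23" "{3, 4} \<notin> edges K23"
    by (auto simp: K23_def doubleton_eq_iff)
  then show ?thesis
    by (simp only: graph_iso_five[OF assms simple_K23] simp_thms)
qed

lemma graph_iso_K23_plus:
  assumes "simple_graph G"
  shows "graph_iso G K23_plus \<longleftrightarrow> (\<exists>x y p q r. distinct [x, y, p, q, r] \<and> verts G = {x, y, p, q, r} \<and>
    {x, y} \<notin> edges G \<and> {x, p} \<in> edges G \<and> {x, q} \<in> edges G \<and> {x, r} \<in> edges G \<and>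
    {y, p} \<in> edges G \<and> {y, q} \<in> edges G \<and> {y, r} \<in> edges G \<and>
    {p, q} \<in> edges G \<and> {p, r} \<notin> edges G \<and> {q, r} \<notin> edges G)"
proof -
  have "{0, 1} \<notin> edges K23_plus" "{0, 2} \<in> edges K23_plus" "{0, 3} \<in> edges K23_plus"
    "{0, 4} \<in> edges K23_plus" "{1, 2} \<in> edges K23_plus" "{1, 3} \<in> edges K23_plus"
    "{1, 4} \<in> edges K23_plus" "{2, 3} \<in> edges K23_plus" "{2, 4} \<notin> edges K23_plus"
    "{3, 4} \<notin> edges K23_plus"
    by (auto simp: K23_plus_def K23_def doubleton_eq_iff)
  then show ?thesis
    by (simp only: graph_iso_five[OF assms simple_K23_plus] simp_thms)
qed

lemma graph_iso_W4:
  assumes "simple_graph G"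
  shows "graph_iso G W4 \<longleftrightarrow> (\<exists>a b c d h. distinct [a, b, c, d, h] \<and> verts G = {a, b, c, d, h} \<and>
    {a, b} \<in> edges G \<and> {a, c} \<notin> edges G \<and> {a, d} \<in> edges G \<and> {a, h} \<in> edges G \<and>
    {b, c} \<in> edges G \<and> {b, d} \<notin> edges G \<and> {b, h} \<in> edges G \<and>
    {c, d} \<in> edges G \<and> {c, h} \<in> edges G \<and> {d, h} \<in> edges G)"
proof -
  have "{0, 1} \<in> edges W4" "{0, 2} \<notin> edges W4" "{0, 3} \<in> edges W4" "{0, 4} \<in> edges W4"
    "{1, 2} \<in> edges W4" "{1, 3} \<notin> edges W4" "{1, 4} \<in> edges W4"
    "{2, 3} \<in> edges W4" "{2, 4} \<in> edges W4" "{3, 4} \<in> edges W4"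
    by (auto simp: W4_def doubleton_eq_iff)
  then show ?thesis
    by (simp only: graph_iso_five[OF assms simple_W4] simp_thms)
qed

section \<open>Choosability of the exceptional graphs\<close>

lemma list_colorable_five:
  assumes G: "simple_graph G" and V: "verts G = {a, b, c, d, e}" and dist: "distinct [a, b, c, d, e]"
    and L: "i \<in> L a" "j \<in> L b" "k \<in> L c" "l \<in> L d" "m \<in> L e"
    and col: "{a, b} \<in> edges G \<Longrightarrow> i \<noteq> j" "{a, c} \<in> edges G \<Longrightarrow> i \<noteq> k" "{a, d} \<in> edges G \<Longrightarrow> i \<noteq> l"
      "{a, e} \<in> edges G \<Longrightarrow> i \<noteq> m" "{b, c} \<in> edges G \<Longrightarrow> j \<noteq> k" "{b, d} \<in> edges G \<Longrightarrow> j \<noteq> l"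
      "{b, e} \<in> edges G \<Longrightarrow> j \<noteq> m" "{c, d} \<in> edges G \<Longrightarrow> k \<noteq> l" "{c, e} \<in> edges G \<Longrightarrow> k \<noteq> m"
      "{d, e} \<in> edges G \<Longrightarrow> l \<noteq> m"
  shows "list_colorable G L"
proof -
  define \<kappa> where "\<kappa> v = (if v = a then i else if v = b then j else if v = c then k
    else if v = d then l else m)" for v
  have \<kappa>: "\<kappa> a = i" "\<kappa> b = j" "\<kappa> c = k" "\<kappa> d = l" "\<kappa> e = m" using dist by (auto simp: \<kappa>_def)
  have "\<kappa> u \<noteq> \<kappa> v" if uv: "{u, v} \<in> edges G" for u v
  proof -
    have "u \<in> {a, b, c, d, e}" "v \<in> {a, b, c, d, e}" "u \<noteq> v" "{v, u} \<in> edges G"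
      using edgeD[OF G uv] V uv by (simp_all add: insert_commute)
    then show ?thesis using uv col \<kappa> by (elim insertE emptyE) auto
  qed
  then show ?thesis
    unfolding list_colorable_def proper_coloring_def V using \<kappa> L by (intro exI[of _ \<kappa>]) auto
qed


lemma ex_avoid_one: "2 \<le> card S \<Longrightarrow> \<exists>s\<in>S. s \<noteq> a" for S :: "nat set"
  by (metis card_le_Suc0_iff_eq card.infinite not_numeral_le_zero numeral_2_eq_2 not_less_eq_eq)

lemma ex_avoid_two:
  assumes "3 \<le> card S"
  shows "\<exists>s\<in>S. s \<noteq> a \<and> s \<noteq> b"
proof (rule ccontr)
  assume "\<not> ?thesis"
  then have "S \<subseteq> {a, b}" by auto
  then have "card S \<le> card {a, b}" by (intro card_mono) auto
  also have "\<dots> \<le> 2" by (simp add: card_insert_if)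
  finally show False using assms by simp
qed

lemma ex_avoid_pair:
  assumes "card S = 2" "S \<noteq> {a, b}"
  shows "\<exists>s\<in>S. s \<noteq> a \<and> s \<noteq> b"
proof (rule ccontr)
  assume "\<not> ?thesis"
  then have "S \<subseteq> {a, b}" by auto
  moreover have "card {a, b} \<le> card S" using assms(1) by (simp add: card_insert_if)
  ultimately show False using assms(2) card_seteq[of "{a, b}" S] by simp
qed

text \<open>If the two vertices \<open>x\<close>, \<open>y\<close> share a colour, they use it and nothing else is lost but one colour.
  Otherwise they have four different colour pairs to choose from, and each of \<open>p\<close>, \<open>q\<close>, \<open>r\<close> is
  blocked by at most one of them, namely by its own list.\<close>

lemma K23_choosable:
  assumes G: "simple_graph G" and V: "verts G = {x, y, p, q, r}" and dist: "distinct [x, y, p, q, r]"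
    and non: "{x, y} \<notin> edges G" "{p, q} \<notin> edges G" "{p, r} \<notin> edges G" "{q, r} \<notin> edges G"
  shows "choosable G (\<lambda>_. 2)"
  unfolding choosable_def
proof (intro allI impI)
  fix L assume "assignment G (\<lambda>_. 2) L"
  then have L: "card (L x) = 2" "card (L y) = 2" "card (L p) = 2" "card (L q) = 2" "card (L r) = 2"
    by (auto simp: assignment_def V)
  have "\<exists>i\<in>L x. \<exists>j\<in>L y. L p \<noteq> {i, j} \<and> L q \<noteq> {i, j} \<and> L r \<noteq> {i, j}"
  proof (cases "L x \<inter> L y = {}")
    case False
    then obtain i where i: "i \<in> L x" "i \<in> L y" by auto
    then show ?thesis using L by (intro bexI[of _ i]) auto
  next
    case True
    obtain a a' where a: "L x = {a, a'}" "a \<noteq> a'" using L(1) by (auto simp: card_2_iff)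
    obtain b b' where b: "L y = {b, b'}" "b \<noteq> b'" using L(2) by (auto simp: card_2_iff)
    have four: "card {{a, b}, {a, b'}, {a', b}, {a', b'}} = 4"
      using True a b by (auto simp: card_insert_if doubleton_eq_iff)
    have three: "card {L p, L q, L r} \<le> 3" by (simp add: card_insert_if)
    have "\<not> {{a, b}, {a, b'}, {a', b}, {a', b'}} \<subseteq> {L p, L q, L r}"
    proof
      assume "{{a, b}, {a, b'}, {a', b}, {a', b'}} \<subseteq> {L p, L q, L r}"
      then have "4 \<le> card {L p, L q, L r}" unfolding four[symmetric] by (intro card_mono) auto
      with three show False by linarith
    qed
    then obtain X where "X \<in> {{a, b}, {a, b'}, {a', b}, {a', b'}}" "X \<notin> {L p, L q, L r}" by blast
    moreover from this obtain i j where "i \<in> L x" "j \<in> L y" "X = {i, j}" using a b by auto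
    ultimately show ?thesis by (metis insertCI)
  qed
  then obtain i j where ij: "i \<in> L x" "j \<in> L y" "L p \<noteq> {i, j}" "L q \<noteq> {i, j}" "L r \<noteq> {i, j}"
    by blast
  obtain k where k: "k \<in> L p" "k \<noteq> i" "k \<noteq> j" using ex_avoid_pair[OF L(3) ij(3)] by blast
  obtain l where l: "l \<in> L q" "l \<noteq> i" "l \<noteq> j" using ex_avoid_pair[OF L(4) ij(4)] by blast
  obtain m where m: "m \<in> L r" "m \<noteq> i" "m \<noteq> j" using ex_avoid_pair[OF L(5) ij(5)] by blast
  show "list_colorable G L"
    by (rule list_colorable_five[OF G V dist ij(1,2) k(1) l(1) m(1)]) (use non k l m in auto)
qed

text \<open>Here \<open>A\<close>, \<open>B\<close> are the lists of the two nonadjacent vertices joined to everything else, and \<open>C\<close>, \<open>D\<close>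
  those of the additional edge. Using \<open>a\<close> on \<open>A\<close> costs \<open>C\<close> nothing; if it would cost \<open>D\<close> something,
  then \<open>a\<close> is instead kept for \<open>D\<close>, where it conflicts neither with \<open>B\<close> nor with \<open>C\<close>.\<close>

lemma K23_plus_colours_disjoint:
  fixes A B C D E :: "nat set"
  assumes card: "card A = 2" "card B = 2" "card C = 3" "card D = 2" "card E = 2"
    and disj: "A \<inter> B = {}" and a: "a \<in> A" "a \<notin> C"
  obtains i j k l m where "i \<in> A" "j \<in> B" "k \<in> C" "l \<in> D" "m \<in> E"
    "k \<notin> {i, j}" "l \<notin> {i, j}" "m \<notin> {i, j}" "k \<noteq> l"
proof (cases "a \<in> D")
  case True
  obtain i where i: "i \<in> A" "i \<noteq> a" using ex_avoid_one[of A a] card by auto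
  obtain m where m: "m \<in> E" "m \<noteq> i" using ex_avoid_one[of E i] card by auto
  obtain j where j: "j \<in> B" "j \<noteq> m" using ex_avoid_one[of B m] card by auto
  obtain k where k: "k \<in> C" "k \<noteq> i" "k \<noteq> j" using ex_avoid_two[of C i j] card by auto
  have "a \<noteq> j" "k \<noteq> a" using disj a j k by auto
  with i j k m True show thesis by (intro that[of i j k a m]) auto
next
  case False
  obtain m where m: "m \<in> E" "m \<noteq> a" using ex_avoid_one[of E a] card by auto
  obtain j where j: "j \<in> B" "j \<noteq> m" using ex_avoid_one[of B m] card by auto
  obtain l where l: "l \<in> D" "l \<noteq> j" using ex_avoid_one[of D j] card by auto
  obtain k where k: "k \<in> C" "k \<noteq> j" "k \<noteq> l" using ex_avoid_two[of C j l] card by auto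
  have "k \<noteq> a" "l \<noteq> a" using False a l k by auto
  with a j k l m show thesis by (intro that[of a j k l m]) auto
qed

text \<open>The wheel is two nonadjacent vertices (lists \<open>A\<close>, \<open>B\<close>) joined to a path (lists \<open>C\<close>, \<open>H\<close>, \<open>E\<close>, with the
  hub in the middle). Again \<open>a\<close> is free of charge for \<open>C\<close>. It is used on \<open>A\<close>, except when the hub can
  profit from it and \<open>E\<close> has a colour in \<open>B\<close>; then the hub takes \<open>a\<close>.\<close>

lemma W4_colours_disjoint:
  fixes A B C H E :: "nat set"
  assumes card: "card A = 2" "card B = 2" "card C = 3" "card H = 3" "card E = 2"
    and disj: "A \<inter> B = {}" and a: "a \<in> A" "a \<notin> C"
  obtains i j k l m where "i \<in> A" "j \<in> B" "k \<in> C" "l \<in> H" "m \<in> E"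
    "k \<notin> {i, j}" "l \<notin> {i, j}" "m \<notin> {i, j}" "k \<noteq> l" "l \<noteq> m"
proof -
  consider "a \<notin> H" | "E \<inter> B = {}" | m where "a \<in> H" "m \<in> E" "m \<in> B" by blast
  then show thesis
  proof cases
    case 1
    obtain m where m: "m \<in> E" "m \<noteq> a" using ex_avoid_one[of E a] card by auto
    obtain j where j: "j \<in> B" "j \<noteq> m" using ex_avoid_one[of B m] card by auto
    obtain l where l: "l \<in> H" "l \<noteq> j" "l \<noteq> m" using ex_avoid_two[of H j m] card by auto
    obtain k where k: "k \<in> C" "k \<noteq> j" "k \<noteq> l" using ex_avoid_two[of C j l] card by auto
    have "k \<noteq> a" "l \<noteq> a" using 1 a l k by auto
    with a j k l m show thesis by (intro that[of a j k l m]) auto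
  next
    case 2
    obtain m where m: "m \<in> E" "m \<noteq> a" using ex_avoid_one[of E a] card by auto
    obtain l where l: "l \<in> H" "l \<noteq> a" "l \<noteq> m" using ex_avoid_two[of H a m] card by auto
    obtain j where j: "j \<in> B" "j \<noteq> l" using ex_avoid_one[of B l] card by auto
    obtain k where k: "k \<in> C" "k \<noteq> j" "k \<noteq> l" using ex_avoid_two[of C j l] card by auto
    have "k \<noteq> a" "m \<noteq> j" using 2 a m j k by auto
    with a j k l m show thesis by (intro that[of a j k l m]) auto
  next
    case 3
    obtain i where i: "i \<in> A" "i \<noteq> a" using ex_avoid_one[of A a] card by auto
    obtain j where j: "j \<in> B" "j \<noteq> m" using ex_avoid_one[of B m] card by auto
    obtain k where k: "k \<in> C" "k \<noteq> i" "k \<noteq> j" using ex_avoid_two[of C i j] card by auto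
    have "a \<noteq> j" "a \<noteq> m" "m \<noteq> i" "k \<noteq> a" using disj a i j k 3 by auto
    with i j k 3 show thesis by (intro that[of i j k a m]) auto
  qed
qed

text \<open>Four colours do not fit into a list of three; this is the source of the colour that is free of
  charge in the two preceding lemmas.\<close>

lemma disjoint_pairs_not_covered:
  fixes A B C :: "nat set"
  assumes "card A = 2" "card B = 2" "card C = 3" "A \<inter> B = {}"
  obtains a where "a \<in> A" "a \<notin> C" | b where "b \<in> B" "b \<notin> C"
proof -
  have fin: "finite A" "finite B" "finite C" using assms card.infinite by fastforce+
  then have "card (A \<union> B) = 4" using assms by (simp add: card_Un_disjoint)
  then have "\<not> A \<union> B \<subseteq> C" using card_mono[OF fin(3), of "A \<union> B"] assms(3) by auto
  then show thesis using that by blast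
qed

lemma K23_plus_choosable:
  assumes G: "simple_graph G" and V: "verts G = {x, y, p, q, r}" and dist: "distinct [x, y, p, q, r]"
    and non: "{x, y} \<notin> edges G" "{p, r} \<notin> edges G" "{q, r} \<notin> edges G"
  shows "choosable G ((\<lambda>_. 2)(p := 3))"
  unfolding choosable_def
proof (intro allI impI)
  fix L assume "assignment G ((\<lambda>_. 2)(p := 3)) L"
  then have L: "card (L x) = 2" "card (L y) = 2" "card (L p) = 3" "card (L q) = 2" "card (L r) = 2"
    using dist by (auto simp: assignment_def V)
  have colour: "list_colorable G L"
    if "i \<in> L x" "j \<in> L y" "k \<in> L p" "l \<in> L q" "m \<in> L r"
      "k \<notin> {i, j}" "l \<notin> {i, j}" "m \<notin> {i, j}" "k \<noteq> l" for i j k l m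
    using that non by (intro list_colorable_five[OF G V dist, of i L j k l m]) auto
  show "list_colorable G L"
  proof (cases "L x \<inter> L y = {}")
    case False
    then obtain i where i: "i \<in> L x" "i \<in> L y" by auto
    obtain l where l: "l \<in> L q" "l \<noteq> i" using ex_avoid_one[of "L q" i] L by auto
    obtain m where m: "m \<in> L r" "m \<noteq> i" using ex_avoid_one[of "L r" i] L by auto
    obtain k where k: "k \<in> L p" "k \<noteq> i" "k \<noteq> l" using ex_avoid_two[of "L p" i l] L by auto
    from i k l m show ?thesis by (intro colour[of i i k l m]) auto
  next
    case True
    show ?thesis
    proof (rule disjoint_pairs_not_covered[OF L(1-3) True])
      fix a assume "a \<in> L x" "a \<notin> L p"
      then show ?thesis by (rule K23_plus_colours_disjoint[OF L True]) (rule colour)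
    next
      fix b assume b: "b \<in> L y" "b \<notin> L p"
      have "L y \<inter> L x = {}" using True by auto
      from K23_plus_colours_disjoint[OF L(2,1,3-5) this b] obtain j i k l m where
        "j \<in> L y" "i \<in> L x" "k \<in> L p" "l \<in> L q" "m \<in> L r"
        "k \<notin> {j, i}" "l \<notin> {j, i}" "m \<notin> {j, i}" "k \<noteq> l" by metis
      then show ?thesis by (intro colour[of i j k l m]) auto
    qed
  qed
qed

lemma W4_choosable:
  assumes G: "simple_graph G" and V: "verts G = {a, b, c, d, h}" and dist: "distinct [a, b, c, d, h]"
    and non: "{a, c} \<notin> edges G" "{b, d} \<notin> edges G"
  shows "choosable G ((\<lambda>_. 2)(b := 3, h := 3))"
  unfolding choosable_def
proof (intro allI impI)
  fix L assume "assignment G ((\<lambda>_. 2)(b := 3, h := 3)) L"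
  then have L: "card (L a) = 2" "card (L c) = 2" "card (L b) = 3" "card (L h) = 3" "card (L d) = 2"
    using dist by (auto simp: assignment_def V)
  have colour: "list_colorable G L"
    if "i \<in> L a" "j \<in> L c" "k \<in> L b" "l \<in> L h" "m \<in> L d"
      "k \<notin> {i, j}" "l \<notin> {i, j}" "m \<notin> {i, j}" "k \<noteq> l" "l \<noteq> m" for i j k l m
    using that non by (intro list_colorable_five[OF G V dist, of i L k j m l]) auto
  show "list_colorable G L"
  proof (cases "L a \<inter> L c = {}")
    case False
    then obtain i where i: "i \<in> L a" "i \<in> L c" by auto
    obtain m where m: "m \<in> L d" "m \<noteq> i" using ex_avoid_one[of "L d" i] L by auto
    obtain l where l: "l \<in> L h" "l \<noteq> i" "l \<noteq> m" using ex_avoid_two[of "L h" i m] L by auto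
    obtain k where k: "k \<in> L b" "k \<noteq> i" "k \<noteq> l" using ex_avoid_two[of "L b" i l] L by auto
    from i k l m show ?thesis by (intro colour[of i i k l m]) auto
  next
    case True
    show ?thesis
    proof (rule disjoint_pairs_not_covered[OF L(1-3) True])
      fix x assume "x \<in> L a" "x \<notin> L b"
      then show ?thesis by (rule W4_colours_disjoint[OF L True]) (rule colour)
    next
      fix x assume x: "x \<in> L c" "x \<notin> L b"
      have "L c \<inter> L a = {}" using True by auto
      from W4_colours_disjoint[OF L(2,1,3-5) this x] obtain j i k l m where
        "j \<in> L c" "i \<in> L a" "k \<in> L b" "l \<in> L h" "m \<in> L d"
        "k \<notin> {j, i}" "l \<notin> {j, i}" "m \<notin> {j, i}" "k \<noteq> l" "l \<noteq> m" by metis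
      then show ?thesis by (intro colour[of i j k l m]) auto
    qed
  qed
qed

section \<open>Deficient choice functions on five vertices\<close>

lemma fsize_five:
  "verts G = {a, b, c, d, e} \<Longrightarrow> distinct [a, b, c, d, e] \<Longrightarrow> fsize G f = f a + f b + f c + f d + f e"
  by (simp add: fsize_def)

lemma obtain_five:
  assumes "card V = 5" "a \<in> V" "b \<in> V" "a \<noteq> b"
  obtains c d e where "V = {a, b, c, d, e}" "distinct [a, b, c, d, e]"
proof -
  have fin: "finite V" using assms(1) card.infinite by fastforce
  then have "card (V - {a, b}) = 3" using assms by (simp add: card_Diff_subset)
  then obtain c d e where cde: "V - {a, b} = {c, d, e}" "c \<noteq> d" "d \<noteq> e" "c \<noteq> e"
    by (auto simp: card_3_iff)
  have "V = {a, b, c, d, e}" using cde(1) assms by auto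
  moreover have "c \<in> V - {a, b}" "d \<in> V - {a, b}" "e \<in> V - {a, b}" unfolding cde(1) by simp_all
  then have "distinct [a, b, c, d, e]" using cde(2-4) assms(4) by auto
  ultimately show thesis by (rule that)
qed

lemma handshake_five:
  assumes G: "simple_graph G" and V: "verts G = {a, b, c, d, e}" and dist: "distinct [a, b, c, d, e]"
  shows "card (neighbours G a) + card (neighbours G b) + card (neighbours G c)
    + card (neighbours G d) + card (neighbours G e) = 2 * card (edges G)"
proof -
  have sym: "{b, a} = {a, b}" "{c, a} = {a, c}" "{d, a} = {a, d}" "{e, a} = {a, e}"
    "{c, b} = {b, c}" "{d, b} = {b, d}" "{e, b} = {b, e}" "{d, c} = {c, d}" "{e, c} = {c, e}"
    "{e, d} = {d, e}" by auto
  have "verts G = {b, a, c, d, e}" "distinct [b, a, c, d, e]"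
    "verts G = {c, a, b, d, e}" "distinct [c, a, b, d, e]"
    "verts G = {d, a, b, c, e}" "distinct [d, a, b, c, e]"
    "verts G = {e, a, b, c, d}" "distinct [e, a, b, c, d]"
    using V dist by auto
  note V' = this
  show ?thesis
    unfolding degree_five[OF G V dist] degree_five[OF G V'(1,2)] degree_five[OF G V'(3,4)]
      degree_five[OF G V'(5,6)] degree_five[OF G V'(7,8)] card_edges_five[OF G V dist] sym
    by simp
qed

text \<open>The values dominate 1, 2, 3, 4 after sorting, and a smallest value of at least 2 adds one more.\<close>

lemma choosable_K4_sum:
  assumes "simple_graph G" "choosable G f" "{a, b} \<in> edges G" "{a, c} \<in> edges G" "{b, c} \<in> edges G"
    "{a, d} \<in> edges G" "{b, d} \<in> edges G" "{c, d} \<in> edges G"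
    and "2 \<le> f a" "2 \<le> f b" "2 \<le> f c" "2 \<le> f d"
  shows "11 \<le> f a + f b + f c + f d"
  using choosable_K4[OF assms(1-8)] choosable_triangle[OF assms(1,2), of a b c]
    choosable_triangle[OF assms(1,2), of a b d] choosable_triangle[OF assms(1,2), of a c d]
    choosable_triangle[OF assms(1,2), of b c d] assms(3-)
  by auto

text \<open>Each of the two copies of \<open>K\<^sub>4\<close> consumes 11 of at most 13, so the two ends of the missing edge
  have value 2. The clique bounds then bring the other three values down to at most 2, 3, 4 in some
  order, where the bad assignment applies.\<close>

lemma not_deficient_one_nonedge:
  assumes D: "deficient G f" and n: "card (verts G) = 5" and N: "card (nonedges G) = 1"
  shows False
proof -
  have G: "simple_graph G" and f: "choosable G f" using D by (auto simp: deficient_def)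
  have m: "card (edges G) = 9" using card_edges_nonedges[OF G] N n by (simp add: choose_two)
  obtain x where x: "nonedges G = {x}" using N by (auto simp: card_1_singleton_iff)
  then obtain a b where ab: "x = {a, b}" "a \<noteq> b" "a \<in> verts G" "b \<in> verts G"
    by (metis insertI1 nonedgeE)
  obtain c d e where V: "verts G = {a, b, c, d, e}" and dist: "distinct [a, b, c, d, e]"
    by (rule obtain_five[OF n ab(3,4,2)])
  have E: "{u, v} \<in> edges G" if "u \<in> verts G" "v \<in> {c, d, e}" "u \<noteq> v" for u v
    using that edge_iff_not_nonedge[of u G v] x ab(1) V dist by (auto simp: doubleton_eq_iff)
  have edges: "{c, d} \<in> edges G" "{c, e} \<in> edges G" "{d, e} \<in> edges G"
    "{a, c} \<in> edges G" "{a, d} \<in> edges G" "{a, e} \<in> edges G"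
    "{b, c} \<in> edges G" "{b, d} \<in> edges G" "{b, e} \<in> edges G"
    "{d, c} \<in> edges G" "{e, c} \<in> edges G" "{e, d} \<in> edges G"
    using E dist by (auto simp: V)
  have ge: "2 \<le> f a" "2 \<le> f b" "2 \<le> f c" "2 \<le> f d" "2 \<le> f e"
    using deficient_ge_2[OF D] V by auto
  have le: "f a + f b + f c + f d + f e \<le> 13"
    using D fsize_five[OF V dist, of f] n m by (simp add: deficient_def greedy_size_def)
  have le4: "f v \<le> 4" if "v \<in> verts G" for v
  proof -
    have "card (neighbours G v) \<le> card (verts G - {v})"
      using neighbours_subset[OF G] finite_verts[OF G] by (intro card_mono) auto
    then show ?thesis using deficient_le_degree[OF D that] that n finite_verts[OF G] by simp
  qed
  have "11 \<le> f a + f c + f d + f e" "11 \<le> f b + f c + f d + f e"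
    using edges ge by (auto intro!: choosable_K4_sum[OF G f])
  then have ab2: "f a \<le> 2" "f b \<le> 2" using le ge by linarith+
  then have four: "4 \<le> f c \<or> 4 \<le> f d \<or> 4 \<le> f e"
    using choosable_K4[OF G f, of a c d e] edges by auto
  have three: "3 \<le> f c \<or> 3 \<le> f d" "3 \<le> f c \<or> 3 \<le> f e" "3 \<le> f d \<or> 3 \<le> f e"
    using choosable_triangle[OF G f, of a c d] choosable_triangle[OF G f, of a c e]
      choosable_triangle[OF G f, of a d e] edges ab2 by auto
  have obstruction: False
    if "{u, v, w} = {c, d, e}" "distinct [u, v, w]" "f u \<le> 2" "f v \<le> 3" for u v w
  proof -
    have uvw: "u \<in> {c, d, e}" "v \<in> {c, d, e}" "w \<in> {c, d, e}" using that(1) by auto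
    have "distinct [a, b, u, v, w]" using uvw that(2) dist by auto
    moreover from this have "{u, v} \<in> edges G" "{u, w} \<in> edges G" "{v, w} \<in> edges G"
      "{a, u} \<in> edges G" "{a, v} \<in> edges G" "{a, w} \<in> edges G"
      "{b, u} \<in> edges G" "{b, v} \<in> edges G" "{b, w} \<in> edges G"
      using E uvw V by auto
    ultimately have "5 \<le> f w" using K5_minus_edge_obstruction[OF G f] ab2 that by blast
    then show False using le4[of w] uvw V by auto
  qed
  have "(f c \<le> 2 \<and> f d \<le> 3) \<or> (f c \<le> 2 \<and> f e \<le> 3) \<or> (f d \<le> 2 \<and> f c \<le> 3)
    \<or> (f d \<le> 2 \<and> f e \<le> 3) \<or> (f e \<le> 2 \<and> f c \<le> 3) \<or> (f e \<le> 2 \<and> f d \<le> 3)"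
    using four three ge le by linarith
  then show False
    using obstruction[of c d e] obstruction[of c e d] obstruction[of d c e] obstruction[of d e c]
      obstruction[of e c d] obstruction[of e d c] dist by (auto simp: insert_commute)
qed

text \<open>If the two missing edges meet in \<open>b\<close>, the other four vertices form a \<open>K\<^sub>4\<close> and consume 11 of at
  most 12, which leaves less than 2 for \<open>b\<close>. So they are disjoint.\<close>

lemma deficient_two_nonedges_W4:
  assumes D: "deficient G f" and n: "card (verts G) = 5" and N: "card (nonedges G) = 2"
  shows "graph_iso G W4"
proof -
  have G: "simple_graph G" and f: "choosable G f" using D by (auto simp: deficient_def)
  have m: "card (edges G) = 8" using card_edges_nonedges[OF G] N n by (simp add: choose_two)
  obtain x y where xy: "nonedges G = {x, y}" "x \<noteq> y" using N by (auto simp: card_2_iff)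
  show ?thesis
  proof (cases "x \<inter> y = {}")
    case True
    obtain a b where ab: "x = {a, b}" "a \<noteq> b" "a \<in> verts G" "b \<in> verts G"
      using xy by (metis insertI1 nonedgeE)
    obtain c d where cd: "y = {c, d}" "c \<noteq> d" "c \<in> verts G" "d \<in> verts G"
      using xy by (metis insertI1 insertI2 nonedgeE)
    have abcd: "distinct [a, b, c, d]" using ab cd True by auto
    then have "card (verts G - {a, b, c, d}) = 1"
      using n ab(3,4) cd(3,4) finite_verts[OF G] by (simp add: card_Diff_subset)
    then obtain h where h: "verts G - {a, b, c, d} = {h}" by (auto simp: card_1_singleton_iff)
    then have V: "verts G = {a, c, b, d, h}" using ab(3,4) cd(3,4) by auto
    have "h \<in> verts G - {a, b, c, d}" unfolding h by simp
    then have dist: "distinct [a, c, b, d, h]" using abcd by auto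
    show ?thesis
      unfolding graph_iso_W4[OF G]
      by (rule exI[of _ a], rule exI[of _ c], rule exI[of _ b], rule exI[of _ d], rule exI[of _ h])
        (use dist in \<open>auto simp: V edge_iff_not_nonedge xy ab cd doubleton_eq_iff\<close>)
  next
    case False
    then obtain b where b: "b \<in> x" "b \<in> y" by auto
    have cards: "card x = 2" "card y = 2" "x \<subseteq> verts G" "y \<subseteq> verts G"
      using xy by (auto simp: nonedges_def)
    obtain a where a: "x = {a, b}" "a \<noteq> b" using cards(1) b(1) by (auto simp: card_2_iff)
    obtain c where c: "y = {c, b}" "c \<noteq> b" using cards(2) b(2) by (auto simp: card_2_iff)
    have ac: "a \<noteq> c" using xy(2) a c by auto
    have "card (verts G - {a, b, c}) = 2"
      using n a c ac cards(3,4) finite_verts[OF G] by (simp add: card_Diff_subset)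
    then obtain d e where de: "verts G - {a, b, c} = {d, e}" "d \<noteq> e" by (auto simp: card_2_iff)
    have V: "verts G = {b, a, c, d, e}" using de cards a c by auto
    have "d \<in> verts G - {a, b, c}" "e \<in> verts G - {a, b, c}" unfolding de by simp_all
    then have dist: "distinct [b, a, c, d, e]" using de(2) a(2) c(2) ac by auto
    have edges: "{a, c} \<in> edges G" "{a, d} \<in> edges G" "{c, d} \<in> edges G" "{a, e} \<in> edges G"
      "{c, e} \<in> edges G" "{d, e} \<in> edges G" "{b, a} \<notin> edges G" "{b, c} \<notin> edges G"
      using dist by (auto simp: V edge_iff_not_nonedge xy a c doubleton_eq_iff)
    have ge: "2 \<le> f a" "2 \<le> f b" "2 \<le> f c" "2 \<le> f d" "2 \<le> f e"
      using deficient_ge_2[OF D] V by auto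
    have "11 \<le> f a + f c + f d + f e" using edges ge by (intro choosable_K4_sum[OF G f])
    moreover have "f b + f a + f c + f d + f e \<le> 12"
      using D fsize_five[OF V dist, of f] n m by (simp add: deficient_def greedy_size_def)
    ultimately show ?thesis using ge by linarith
  qed
qed

text \<open>All values are 2, so there is no triangle, and by counting some \<open>x\<close> has degree at least 3. Three
  neighbours of \<open>x\<close> are independent, and the degree bound joins all of them to the fifth vertex.\<close>

lemma deficient_six_edges_K23:
  assumes D: "deficient G f" and n: "card (verts G) = 5" and m: "card (edges G) = 6"
  shows "graph_iso G K23"
proof -
  have G: "simple_graph G" and f: "choosable G f" using D by (auto simp: deficient_def)
  have "\<exists>xs. length xs = 5 \<and> set xs = verts G \<and> distinct xs"
    using finite_distinct_list[OF finite_verts[OF G]] n distinct_card by metis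
  then obtain a b c d e where "set [a, b, c, d, e] = verts G \<and> distinct [a, b, c, d, e]"
    unfolding ex_list_length_five by blast
  then have V: "verts G = {a, b, c, d, e}" and dist: "distinct [a, b, c, d, e]" by simp_all
  have ge: "2 \<le> f a" "2 \<le> f b" "2 \<le> f c" "2 \<le> f d" "2 \<le> f e"
    using deficient_ge_2[OF D] V by auto
  have "f a + f b + f c + f d + f e \<le> 10"
    using D fsize_five[OF V dist, of f] n m by (simp add: deficient_def greedy_size_def)
  then have two: "f v \<le> 2" if "v \<in> verts G" for v using that ge V by auto
  have no_triangle: "{v, w} \<notin> edges G" if "{u, v} \<in> edges G" "{u, w} \<in> edges G" for u v w
    using choosable_triangle[OF G f that] two[of u] two[of v] two[of w] edgeD[OF G that(1)]
      edgeD[OF G that(2)] by auto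
  have "\<exists>x\<in>verts G. 3 \<le> card (neighbours G x)"
    using handshake_five[OF G V dist] m V by auto
  then obtain x where x: "x \<in> verts G" "3 \<le> card (neighbours G x)" by blast
  then obtain T where T: "T \<subseteq> neighbours G x" "card T = 3"
    by (meson obtain_subset_with_card_n)
  then obtain p q r where pqr: "T = {p, q, r}" "distinct [p, q, r]"
    by (auto simp: card_3_iff)
  have xpqr: "{x, p} \<in> edges G" "{x, q} \<in> edges G" "{x, r} \<in> edges G"
    using T pqr by (auto simp: neighbours_def)
  note loopless = edgeD(3)[OF G xpqr(1)] edgeD(3)[OF G xpqr(2)] edgeD(3)[OF G xpqr(3)]
  have sub: "{x, p, q, r} \<subseteq> verts G" using edgeD[OF G xpqr(1)] edgeD[OF G xpqr(2)] edgeD[OF G xpqr(3)] by auto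
  have "card (verts G - {x, p, q, r}) = 1"
    using n sub pqr(2) loopless finite_verts[OF G] by (simp add: card_Diff_subset)
  then obtain y where y: "verts G - {x, p, q, r} = {y}" by (auto simp: card_1_singleton_iff)
  have V': "verts G = {x, y, p, q, r}" using y sub by auto
  have "y \<in> verts G - {x, p, q, r}" unfolding y by simp
  then have dist': "distinct [x, y, p, q, r]" using pqr(2) loopless by auto
  have non: "{p, q} \<notin> edges G" "{p, r} \<notin> edges G" "{q, r} \<notin> edges G"
    using no_triangle xpqr by blast+
  have y_adj: "{v, y} \<in> edges G" if v: "v \<in> {p, q, r}" for v
  proof (rule ccontr)
    assume "{v, y} \<notin> edges G"
    then have "neighbours G v \<subseteq> {x}"
      using neighbours_subset[OF G, of v] non v V' by (auto simp: neighbours_def insert_commute)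
    then have "card (neighbours G v) \<le> 1" using card_mono[of "{x}"] by fastforce
    then show False using deficient_degree_ge_2[OF D, of v] v V' by auto
  qed
  then have ypqr: "{y, p} \<in> edges G" "{y, q} \<in> edges G" "{y, r} \<in> edges G"
    by (auto simp: insert_commute)
  have "{x, y} \<notin> edges G" using no_triangle[of p x y] xpqr(1) y_adj[of p] by (auto simp: insert_commute)
  then show ?thesis
    unfolding graph_iso_K23[OF G] using V' dist' xpqr ypqr non by blast
qed

text \<open>The next two lemmas concern a graph on four vertices \<open>s\<close>, \<open>p\<close>, \<open>q\<close>, \<open>r\<close>, given by the truth values
  of its six adjacencies. A triangle-free one has at most four edges, with equality only for a
  4-cycle.\<close>

lemma triangle_free_four:
  fixes sp sq sr pq pr qr :: bool
  assumes "\<not> (sp \<and> sq \<and> pq)" "\<not> (sp \<and> sr \<and> pr)" "\<not> (sq \<and> sr \<and> qr)" "\<not> (pq \<and> pr \<and> qr)"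
    and "(4 :: nat) \<le> of_bool sp + of_bool sq + of_bool sr + of_bool pq + of_bool pr + of_bool qr"
  shows "of_bool sp + of_bool sq + of_bool sr + of_bool pq + of_bool pr + of_bool qr = (4 :: nat)"
    and "\<not> sp \<and> \<not> qr \<and> sq \<and> sr \<and> pq \<and> pr \<or> \<not> sq \<and> \<not> pr \<and> sp \<and> sr \<and> pq \<and> qr
      \<or> \<not> sr \<and> \<not> pq \<and> sp \<and> sq \<and> pr \<and> qr"
  using assms by (cases sp; cases sq; cases sr; cases pq; cases pr; cases qr; simp)+

text \<open>Two disjoint edges are avoided only by stars and triangles, as soon as there are three edges.\<close>

lemma matching_free_four:
  fixes sp sq sr pq pr qr :: bool
  assumes "\<not> (sp \<and> qr)" "\<not> (sq \<and> pr)" "\<not> (sr \<and> pq)"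
    and "(3 :: nat) \<le> of_bool sp + of_bool sq + of_bool sr + of_bool pq + of_bool pr + of_bool qr"
  obtains "sp \<and> sq \<and> sr" | "sp \<and> pq \<and> pr" | "sq \<and> pq \<and> qr" | "sr \<and> pr \<and> qr"
    | "sp \<and> sq \<and> pq" | "sp \<and> sr \<and> pr" | "sq \<and> sr \<and> qr" | "pq \<and> pr \<and> qr"
  using assms by (cases sp; cases sq; cases sr; cases pq; cases pr; cases qr; simp)

text \<open>The values are 2 except for at most one 3, at \<open>h\<close>, so \<open>G - h\<close> is triangle-free. If \<open>h\<close> is joined
  to everything, then \<open>G - h\<close> has three edges; two disjoint ones give a butterfly and a star gives a
  book. Otherwise \<open>G - h\<close> has at least four edges, hence is a 4-cycle, and \<open>h\<close> has degree 3.\<close>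

lemma deficient_seven_edges_K23_plus:
  assumes D: "deficient G f" and n: "card (verts G) = 5" and m: "card (edges G) = 7"
  shows "graph_iso G K23_plus"
proof -
  have G: "simple_graph G" and f: "choosable G f" using D by (auto simp: deficient_def)
  have ge: "2 \<le> f v" if "v \<in> verts G" for v using deficient_ge_2[OF D that] .
  have sum: "fsize G f \<le> 11" using D n m by (simp add: deficient_def greedy_size_def)
  have "verts G \<noteq> {}" using n by auto
  then have "Max (f ` verts G) \<in> f ` verts G" using finite_verts[OF G] by (intro Max_in) auto
  then obtain h where h: "h \<in> verts G" and "f h = Max (f ` verts G)" by auto
  then have max: "f v \<le> f h" if "v \<in> verts G" for v using that finite_verts[OF G] by simp
  have "card (verts G - {h}) = 4" using n h finite_verts[OF G] by simp
  then have "verts G - {h} \<noteq> {}" by (metis card.empty zero_neq_numeral)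
  then obtain t where t: "t \<in> verts G - {h}" by blast
  \<comment> \<open>A nonneighbour of \<open>h\<close> if there is one, so that a single case split on \<open>hs\<close> decides the degree.\<close>
  obtain s where s: "s \<in> verts G" "s \<noteq> h"
    "{h, s} \<in> edges G \<Longrightarrow> \<forall>v\<in>verts G - {h}. {h, v} \<in> edges G"
  proof (cases "\<exists>s\<in>verts G - {h}. {h, s} \<notin> edges G")
    case True
    then show ?thesis using that by blast
  next
    case False
    then show ?thesis using that[of t] t by blast
  qed
  obtain p q r where V: "verts G = {h, s, p, q, r}" and dist: "distinct [h, s, p, q, r]"
    by (rule obtain_five[OF n h s(1) s(2)[symmetric]])
  have total: "f h + f s + f p + f q + f r \<le> 11" using sum fsize_five[OF V dist, of f] by simp
  have ge': "2 \<le> f h" "2 \<le> f s" "2 \<le> f p" "2 \<le> f q" "2 \<le> f r" using ge V by auto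
  have le: "f h \<le> 3" "f s \<le> 2" "f p \<le> 2" "f q \<le> 2" "f r \<le> 2"
    using total ge' max[of s] max[of p] max[of q] max[of r] V by auto
  have tri: "\<not> ({u, v} \<in> edges G \<and> {u, w} \<in> edges G \<and> {v, w} \<in> edges G)"
    if "{u, v, w} \<subseteq> {s, p, q, r}" for u v w
    using choosable_triangle[OF G f, of u v w] that le by auto
  have triangles:
    "\<not> ({s, p} \<in> edges G \<and> {s, q} \<in> edges G \<and> {p, q} \<in> edges G)"
    "\<not> ({s, p} \<in> edges G \<and> {s, r} \<in> edges G \<and> {p, r} \<in> edges G)"
    "\<not> ({s, q} \<in> edges G \<and> {s, r} \<in> edges G \<and> {q, r} \<in> edges G)"
    "\<not> ({p, q} \<in> edges G \<and> {p, r} \<in> edges G \<and> {q, r} \<in> edges G)"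
    using tri by auto
  have count: "of_bool ({h, s} \<in> edges G) + of_bool ({h, p} \<in> edges G)
    + of_bool ({h, q} \<in> edges G) + of_bool ({h, r} \<in> edges G) + of_bool ({s, p} \<in> edges G)
    + of_bool ({s, q} \<in> edges G) + of_bool ({s, r} \<in> edges G) + of_bool ({p, q} \<in> edges G)
    + of_bool ({p, r} \<in> edges G) + of_bool ({q, r} \<in> edges G) = (7 :: nat)"
    using card_edges_five[OF G V dist] m by simp
  have sym: "{p, s} = {s, p}" "{q, s} = {s, q}" "{r, s} = {s, r}" "{q, p} = {p, q}" "{r, p} = {p, r}" "{r, q} = {q, r}"
    by auto
  show ?thesis
  proof (cases "{h, s} \<in> edges G")
    case True
    then have hub: "{h, s} \<in> edges G" "{h, p} \<in> edges G" "{h, q} \<in> edges G" "{h, r} \<in> edges G"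
      using s(3) V dist by auto
    have matching: "\<not> ({s, p} \<in> edges G \<and> {q, r} \<in> edges G)"
      "\<not> ({s, q} \<in> edges G \<and> {p, r} \<in> edges G)" "\<not> ({s, r} \<in> edges G \<and> {p, q} \<in> edges G)"
      using butterfly_obstruction[OF G f, of s p q r h] butterfly_obstruction[OF G f, of s q p r h]
        butterfly_obstruction[OF G f, of s r p q h] hub le dist by auto
    have star: "\<not> ({v, x} \<in> edges G \<and> {v, y} \<in> edges G \<and> {v, z} \<in> edges G)"
      if "{h, v} \<in> edges G" "{h, x} \<in> edges G" "{h, y} \<in> edges G" "{h, z} \<in> edges G"
        "distinct [h, v, x, y, z]" "f v \<le> 2" "f x \<le> 2" "f y \<le> 2" "f z \<le> 2" for v x y z
      using book_obstruction[OF G f that(1-4) _ _ _ that(5-9)] le(1) by linarith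
    have dist': "distinct [h, p, s, q, r]" "distinct [h, q, s, p, r]" "distinct [h, r, s, p, q]"
      using dist by auto
    have stars: "\<not> ({s, p} \<in> edges G \<and> {s, q} \<in> edges G \<and> {s, r} \<in> edges G)"
      "\<not> ({s, p} \<in> edges G \<and> {p, q} \<in> edges G \<and> {p, r} \<in> edges G)"
      "\<not> ({s, q} \<in> edges G \<and> {p, q} \<in> edges G \<and> {q, r} \<in> edges G)"
      "\<not> ({s, r} \<in> edges G \<and> {p, r} \<in> edges G \<and> {q, r} \<in> edges G)"
      using star[OF hub(1,2,3,4) dist le(2,3,4,5)] star[OF hub(2,1,3,4) dist'(1) le(3,2,4,5)]
        star[OF hub(3,1,2,4) dist'(2) le(4,2,3,5)] star[OF hub(4,1,2,3) dist'(3) le(5,2,3,4)]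
      unfolding sym by blast+
    have "(3 :: nat) \<le> of_bool ({s, p} \<in> edges G) + of_bool ({s, q} \<in> edges G)
        + of_bool ({s, r} \<in> edges G) + of_bool ({p, q} \<in> edges G)
        + of_bool ({p, r} \<in> edges G) + of_bool ({q, r} \<in> edges G)"
      using count hub by (simp add: numeral_eq_Suc)
    then show ?thesis
      by (rule matching_free_four[OF matching]) (use stars triangles in blast)+
  next
    case False
    have of_bool_le: "of_bool P \<le> (1 :: nat)" for P by simp
    have four: "(4 :: nat) \<le> of_bool ({s, p} \<in> edges G) + of_bool ({s, q} \<in> edges G)
        + of_bool ({s, r} \<in> edges G) + of_bool ({p, q} \<in> edges G)
        + of_bool ({p, r} \<in> edges G) + of_bool ({q, r} \<in> edges G)"
      using count False of_bool_le[of "{h, p} \<in> edges G"] of_bool_le[of "{h, q} \<in> edges G"]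
        of_bool_le[of "{h, r} \<in> edges G"] by simp
    have "of_bool ({h, p} \<in> edges G) + of_bool ({h, q} \<in> edges G) + of_bool ({h, r} \<in> edges G)
        = (3 :: nat)"
      using count False triangle_free_four(1)[OF triangles four] by simp
    then have hpqr: "{h, p} \<in> edges G" "{h, q} \<in> edges G" "{h, r} \<in> edges G"
      by (auto simp: of_bool_def split: if_splits)
    have iso: "graph_iso G K23_plus"
      if "{h, t} \<in> edges G" "{h, u} \<in> edges G" "{h, v} \<in> edges G" "{s, t} \<notin> edges G" "{u, v} \<notin> edges G"
       "{s, u} \<in> edges G" "{s, v} \<in> edges G" "{t, u} \<in> edges G" "{t, v} \<in> edges G"
       "distinct [h, s, t, u, v]" "verts G = {h, s, t, u, v}" for t u v
    proof -
      have "verts G = {u, v, h, t, s}" using that(11) by auto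
      moreover have "distinct [u, v, h, t, s]" using that(10) by auto
      moreover have "{u, h} = {h, u}" "{v, h} = {h, v}" "{u, t} = {t, u}" "{v, t} = {t, v}"
        "{u, s} = {s, u}" "{v, s} = {s, v}" "{t, s} = {s, t}" by auto
      ultimately show ?thesis unfolding graph_iso_K23_plus[OF G] using that(1-9) False by metis
    qed
    show ?thesis
      using triangle_free_four(2)[OF triangles four]
    proof (elim disjE conjE)
      assume "{s, p} \<notin> edges G" "{q, r} \<notin> edges G" "{s, q} \<in> edges G" "{s, r} \<in> edges G"
        "{p, q} \<in> edges G" "{p, r} \<in> edges G"
      then show ?thesis by (intro iso[of p q r]) (use hpqr V dist in auto)
    next
      assume "{s, q} \<notin> edges G" "{p, r} \<notin> edges G" "{s, p} \<in> edges G" "{s, r} \<in> edges G"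
        "{p, q} \<in> edges G" "{q, r} \<in> edges G"
      then show ?thesis by (intro iso[of q p r]) (use hpqr V dist in \<open>auto simp: sym\<close>)
    next
      assume "{s, r} \<notin> edges G" "{p, q} \<notin> edges G" "{s, p} \<in> edges G" "{s, q} \<in> edges G"
        "{p, r} \<in> edges G" "{q, r} \<in> edges G"
      then show ?thesis by (intro iso[of r p q]) (use hpqr V dist in \<open>auto simp: sym\<close>)
    qed
  qed
qed

lemma deficient_five:
  assumes D: "deficient G f" and n: "card (verts G) = 5"
  shows "graph_iso G K23 \<or> graph_iso G K23_plus \<or> graph_iso G W4"
proof -
  have G: "simple_graph G" using D by (simp add: deficient_def)
  have N: "card (nonedges G) \<noteq> 0"
    using deficient_not_complete[OF D] finite_nonedges[OF G] by simp
  have m: "card (edges G) + card (nonedges G) = 10"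
    using card_edges_nonedges[OF G] n by (simp add: choose_two)
  have "card (nonedges G) \<noteq> 1" using not_deficient_one_nonedge[OF D n] by blast
  then have "card (nonedges G) = 2 \<or> card (edges G) = 7 \<or> card (edges G) = 6"
    using deficient_card_edges[OF D] n N m by linarith
  then show ?thesis
    using deficient_two_nonedges_W4[OF D n] deficient_seven_edges_K23_plus[OF D n] deficient_six_edges_K23[OF D n] by blast
qed

text \<open>Saving a second unit would push the value at such a vertex below 2.\<close>

lemma deficient_degree_2:
  assumes D: "deficient G f" and v: "v \<in> verts G" "card (neighbours G v) = 2"
  shows "greedy_size G \<le> fsize G f + 1"
  using choice_value_upper[of G v f] deficient_ge_2[OF D v(1)] D v by (simp add: deficient_def)

section \<open>The sum choice numbers\<close>

theorem mainTheorem3: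
  fixes G :: "'a ugraph"
  assumes "simple_graph G" and "card (verts G) = 5"
  shows "(graph_iso G K23 \<longrightarrow> sum_choice_number G = 10) \<and>
    (graph_iso G K23_plus \<longrightarrow> sum_choice_number G = 11) \<and>
    (graph_iso G W4 \<longrightarrow> sum_choice_number G = 12) \<and>
    (\<not> graph_iso G K23 \<and> \<not> graph_iso G K23_plus \<and> \<not> graph_iso G W4 \<longrightarrow> sc_greedy G)"
proof (intro conjI impI)
  note G = assms(1) and n = assms(2)
  have bound: "greedy_bound (delete_vertex v G)" if "v \<in> verts G" for v
    using greedy_bound_le_four_vertices[OF simple_graph_delete_vertex[OF G]] that n finite_verts[OF G] by simp
  have deficientI: "deficient G f" if "choosable G f" "fsize G f < greedy_size G" for f
    using that G bound by (simp add: deficient_def)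
  {
    assume "graph_iso G K23"
    then obtain x y p q r where dist: "distinct [x, y, p, q, r]" and V: "verts G = {x, y, p, q, r}"
      and E: "{x, y} \<notin> edges G" "{x, p} \<in> edges G" "{x, q} \<in> edges G" "{x, r} \<in> edges G"
        "{y, p} \<in> edges G" "{y, q} \<in> edges G" "{y, r} \<in> edges G"
        "{p, q} \<notin> edges G" "{p, r} \<notin> edges G" "{q, r} \<notin> edges G"
      unfolding graph_iso_K23[OF G] by blast
    have size: "greedy_size G = 11"
      using card_edges_five[OF G V dist] E n by (simp add: greedy_size_def)
    have Vp: "verts G = {p, x, y, q, r}" "distinct [p, x, y, q, r]" using V dist by auto
    have degree: "card (neighbours G p) = 2"
      using degree_five[OF G Vp] E by (simp add: insert_commute)
    show "sum_choice_number G = 10"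
    proof (rule sum_choice_number_eqI)
      show "choosable G (\<lambda>_. 2)" using K23_choosable[OF G V dist] E by blast
      show "fsize G (\<lambda>_. 2) = 10" using fsize_five[OF V dist] by simp
      show "10 \<le> fsize G g" if "choosable G g" for g
        using deficient_degree_2[OF deficientI[OF that], of p] degree V size by fastforce
    qed
  }
  {
    assume "graph_iso G K23_plus"
    then obtain x y p q r where dist: "distinct [x, y, p, q, r]" and V: "verts G = {x, y, p, q, r}"
      and E: "{x, y} \<notin> edges G" "{x, p} \<in> edges G" "{x, q} \<in> edges G" "{x, r} \<in> edges G"
        "{y, p} \<in> edges G" "{y, q} \<in> edges G" "{y, r} \<in> edges G"
        "{p, q} \<in> edges G" "{p, r} \<notin> edges G" "{q, r} \<notin> edges G"
      unfolding graph_iso_K23_plus[OF G] by blast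
    have size: "greedy_size G = 12"
      using card_edges_five[OF G V dist] E n by (simp add: greedy_size_def)
    have Vr: "verts G = {r, x, y, p, q}" "distinct [r, x, y, p, q]" using V dist by auto
    have degree: "card (neighbours G r) = 2"
      using degree_five[OF G Vr] E by (simp add: insert_commute)
    show "sum_choice_number G = 11"
    proof (rule sum_choice_number_eqI)
      show "choosable G ((\<lambda>_. 2)(p := 3))" using K23_plus_choosable[OF G V dist] E by blast
      show "fsize G ((\<lambda>_. 2)(p := 3)) = 11" using fsize_five[OF V dist, of "(\<lambda>_. 2)(p := 3)"] dist by auto
      show "11 \<le> fsize G g" if "choosable G g" for g
        using deficient_degree_2[OF deficientI[OF that], of r] degree V size by fastforce
    qed
  }
  {
    assume "graph_iso G W4"
    then obtain a b c d h where dist: "distinct [a, b, c, d, h]" and V: "verts G = {a, b, c, d, h}"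
      and E: "{a, b} \<in> edges G" "{a, c} \<notin> edges G" "{a, d} \<in> edges G" "{a, h} \<in> edges G"
        "{b, c} \<in> edges G" "{b, d} \<notin> edges G" "{b, h} \<in> edges G"
        "{c, d} \<in> edges G" "{c, h} \<in> edges G" "{d, h} \<in> edges G"
      unfolding graph_iso_W4[OF G] by blast
    have size: "greedy_size G = 13"
      using card_edges_five[OF G V dist] E n by (simp add: greedy_size_def)
    have V': "verts G = {b, a, c, d, h}" "distinct [b, a, c, d, h]"
      "verts G = {c, a, b, d, h}" "distinct [c, a, b, d, h]"
      "verts G = {d, a, b, c, h}" "distinct [d, a, b, c, h]"
      "verts G = {h, a, b, c, d}" "distinct [h, a, b, c, d]"
      using V dist by auto
    have E': "{b, a} \<in> edges G" "{c, b} \<in> edges G" "{d, a} \<in> edges G" "{d, c} \<in> edges G"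
      "{c, a} \<notin> edges G" "{d, b} \<notin> edges G"
      "{h, a} \<in> edges G" "{h, b} \<in> edges G" "{h, c} \<in> edges G" "{h, d} \<in> edges G"
      using E by (simp_all add: insert_commute)
    have degree: "card (neighbours G a) = 3" "card (neighbours G b) = 3" "card (neighbours G c) = 3"
      "card (neighbours G d) = 3" "card (neighbours G h) = 4"
      using degree_five[OF G V dist] degree_five[OF G V'(1,2)] degree_five[OF G V'(3,4)]
        degree_five[OF G V'(5,6)] degree_five[OF G V'(7,8)] E E' by simp_all
    show "sum_choice_number G = 12"
    proof (rule sum_choice_number_eqI)
      show "choosable G ((\<lambda>_. 2)(b := 3, h := 3))" using W4_choosable[OF G V dist] E by blast
      show "fsize G ((\<lambda>_. 2)(b := 3, h := 3)) = 12"
        using fsize_five[OF V dist, of "(\<lambda>_. 2)(b := 3, h := 3)"] dist by auto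
      show "12 \<le> fsize G g" if g: "choosable G g" for g
      proof (rule ccontr)
        assume less: "\<not> 12 \<le> fsize G g"
        \<comment> \<open>Two units below the greedy size, the value at each vertex is less than its degree.\<close>
        have "g v + 2 \<le> card (neighbours G v) + 1" if "v \<in> verts G" for v
          using choice_value_upper[OF G bound[OF that] that g] size less by simp
        then have "g a \<le> 2" "g b \<le> 2" "g c \<le> 2" "g d \<le> 2" "g h \<le> 3"
          using degree V by force+
        moreover have "distinct [h, a, b, c, d]" by (rule V'(8))
        ultimately show False
          using butterfly_obstruction[OF G g E(1) E(8) E'(7-10)] by simp
      qed
    qed
  }
  {
    assume "\<not> graph_iso G K23 \<and> \<not> graph_iso G K23_plus \<and> \<not> graph_iso G W4"
    then have "greedy_size G \<le> fsize G g" if "choosable G g" for g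
      using deficient_five[OF deficientI[OF that] n] by (metis not_le)
    moreover obtain f where "choosable G f" "fsize G f = greedy_size G"
      using greedy_choice_function[OF G] by blast
    ultimately have "sum_choice_number G = greedy_size G" by (intro sum_choice_number_eqI)
    then show "sc_greedy G" by (simp add: sc_greedy_def greedy_size_def)
  }
qed

end
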